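(* Let $b$ be a connected, locally finite graph over $(X,m)$ which is weakly spherically symmetric with respect to some nonempty finite set $O\subseteq X$. Assume that (i) the curvature ratio $\kappa$ is bounded and $\kappa (1)\geq 2$, (ii) for all $r\geq 2$, $\ \kappa(r)\geq \frac{1}{r}+\left(1-\frac{1}{r}\right)\kappa(r-1)$, and (iii) $\gamma$ is a real number with $\displaystyle \frac{1}{k_+(0)\mathrm{vol}(0)}\leq \gamma \leq \frac{\kappa(1)-1}{k_+(0)\mathrm{vol}(0)}.$ For vertices in $S(r)$, $r\ge 0$, define $$ w_\gamma(r):= \begin{cases} k_+(0)\left( 1- \frac{1}{\sqrt{k_+(0)\mathrm{vol}(0)\gamma}}\right), & r=0,\\ k_-(1)\left(1+\kappa(1)-\sqrt{2\kappa(1)}-\sqrt{k_-(1)\mathrm{vol}(1)\gamma}\right), & r=1,\\ k_-(r)\left(1 + \kappa(r)- \sqrt{\kappa(r)\left( 1+\frac{1}{r}\right)} -\sqrt{\kappa(r-1)\left( 1-\frac{1}{r}\right)} \right), & r\geq 2. \end{cases}$$ Then $$E (\varphi)\geq \|\varphi\|^2_{ w_\gamma}, \qquad \varphi \in C_c(X),$$ and $w_\gamma$ is an optimal Hardy weight of $-\Delta$ on $\Omega=X$.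
   Context: Graphs. $X$ is a countable set, $b\colon X\times X\to[0,\infty)$ is symmetric with zero diagonal; $x,y$ are neighbours if $b(x,y)>0$. The graph is connected and locally finite (each vertex has finitely many neighbours). $m\colon X\to(0,\infty)$ is a vertex measure. $C(X)$ is the set of real functions on $X$; $C_c(\Omega)$ is the set of finitely supported functions vanishing outside $\Omega\subseteq X$. $-\Delta f(x)=\frac1{m(x)}\sum_{y}b(x,y)(f(x)-f(y))$, $E(\varphi)=\frac12\sum_{x,y}b(x,y)(\varphi(x)-\varphi(y))^2$, $\|\varphi\|_w^2=\sum_x w(x)\varphi(x)^2m(x)$. Spheres and curvatures. $d$ is the combinatorial graph distance, $|x|=\min_{o\in O}d(x,o)$, $S(r)=\{x:|x|=r\}$, $r\in\mathbb{N}_0$, $\mathrm{vol}(r)=\sum_{x\in S(r)}m(x)$. For $x\in S(r)$, $k_\pm(x)=\frac1{m(x)}\sum_{y\in S(r\pm1)}b(x,y)$ (empty sums are $0$), and $\kappa(x)=k_+(x)/k_-(x)$ for $|x|\ge1$. The graph is weakly spherically symmetric with respect to $O$ if $k_+$ and $k_-$ are spherically symmetric, i.e. depend only on $|x|$; functions depending only on $r=|x|$ are written as functions of $r$. Optimality (for $\Omega=X$). A function $w\ge 0$, not identically zero, is a Hardy weight of $-\Delta$ on $\Omega$ if $E(\varphi)\ge\|\varphi\|_w^2$ for all $\varphi\in C_c(\Omega)$. A Hardy weight $w$ is optimal if: (1) $-\Delta-w$ is critical on $\Omega$: there is a unique (up to multiplication by a constant) positive function $u$ with $-\Delta u-wu\ge0$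 on $\Omega$, called the Agmon ground state; (2) $-\Delta-w$ is null-critical with respect to $w$: the Agmon ground state $u$ satisfies $\sum_{x\in\Omega}u(x)^2w(x)m(x)=\infty$; (3) $w$ is optimal near infinity: for all $\lambda>0$ and all finite $K\subseteq\Omega$, there is $\varphi\in C_c(\Omega\setminus K)$ with $E(\varphi)<(1+\lambda)\|\varphi\|_w^2$.
   Formalization: Optimality of w_γ is asserted only when w_γ is not identically zero; it can vanish (X = N_0, b(r,r+1) = r+1, m = 1, O = {0}, γ = 1), and then it is not a Hardy weight. The inequality E(φ) ≥ ‖φ‖² is unconditional. *)

theory Defs
  imports "HOL-Analysis.Analysis"
begin

text \<open>The vertex set \<open>X\<close> is the set of all elements of the type \<open>'a\<close>, assumed to be countable.\<close>

locale weighted_graph =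
  fixes b :: "'a \<Rightarrow> 'a \<Rightarrow> real" and m :: "'a \<Rightarrow> real"
  assumes countable_vertices: "countable (UNIV :: 'a set)"
    and weight_nonneg: "b x y \<ge> 0"
    and weight_sym: "b x y = b y x"
    and weight_diag: "b x x = 0"
    and measure_pos: "m x > 0"

definition edges :: "('a \<Rightarrow> 'a \<Rightarrow> real) \<Rightarrow> ('a \<times> 'a) set" where
  "edges b = {(x, y). b x y > 0}"

definition connected_graph :: "('a \<Rightarrow> 'a \<Rightarrow> real) \<Rightarrow> bool" where
  "connected_graph b \<longleftrightarrow> (\<forall>x y. (x, y) \<in> (edges b)\<^sup>*)"

definition locally_finite_graph :: "('a \<Rightarrow> 'a \<Rightarrow> real) \<Rightarrow> bool" where
  "locally_finite_graph b \<longleftrightarrow> (\<forall>x. finite {y. b x y > 0})"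

definition Cc :: "'a set \<Rightarrow> ('a \<Rightarrow> real) set" where
  "Cc \<Omega> = {\<phi>. finite {x. \<phi> x \<noteq> 0} \<and> (\<forall>x. x \<notin> \<Omega> \<longrightarrow> \<phi> x = 0)}"

text \<open>The positive operator \<open>-\<Delta>\<close> (note the sign).\<close>

definition neg_laplacian :: "('a \<Rightarrow> 'a \<Rightarrow> real) \<Rightarrow> ('a \<Rightarrow> real) \<Rightarrow> ('a \<Rightarrow> real) \<Rightarrow> 'a \<Rightarrow> real" where
  "neg_laplacian b m f x = 1 / m x * (\<Sum>\<^sub>\<infinity>y\<in>UNIV. b x y * (f x - f y))"

definition energy :: "('a \<Rightarrow> 'a \<Rightarrow> real) \<Rightarrow> ('a \<Rightarrow> real) \<Rightarrow> real" where
  "energy b \<phi> = 1 / 2 * (\<Sum>\<^sub>\<infinity>(x, y)\<in>UNIV. b x y * (\<phi> x - \<phi> y)\<^sup>2)"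

text \<open>The squared weighted norm \<open>\<parallel>\<phi>\<parallel>\<^sub>w\<^sup>2\<close>.\<close>

definition wnorm_sq :: "('a \<Rightarrow> real) \<Rightarrow> ('a \<Rightarrow> real) \<Rightarrow> ('a \<Rightarrow> real) \<Rightarrow> real" where
  "wnorm_sq m w \<phi> = (\<Sum>\<^sub>\<infinity>x\<in>UNIV. w x * (\<phi> x)\<^sup>2 * m x)"


definition graph_dist :: "('a \<Rightarrow> 'a \<Rightarrow> real) \<Rightarrow> 'a \<Rightarrow> 'a \<Rightarrow> nat" where
  "graph_dist b x y = (LEAST n. (x, y) \<in> edges b ^^ n)"

text \<open>\<open>radius b Os x\<close> is \<open>|x|\<close>; it is only used for finite nonempty \<open>Os\<close> in connected graphs.\<close>

definition radius :: "('a \<Rightarrow> 'a \<Rightarrow> real) \<Rightarrow> 'a set \<Rightarrow> 'a \<Rightarrow> nat" where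
  "radius b Os x = Min (graph_dist b x ` Os)"

definition sph :: "('a \<Rightarrow> 'a \<Rightarrow> real) \<Rightarrow> 'a set \<Rightarrow> nat \<Rightarrow> 'a set" where
  "sph b Os r = {x. radius b Os x = r}"

definition vol :: "('a \<Rightarrow> 'a \<Rightarrow> real) \<Rightarrow> ('a \<Rightarrow> real) \<Rightarrow> 'a set \<Rightarrow> nat \<Rightarrow> real" where
  "vol b m Os r = (\<Sum>\<^sub>\<infinity>x\<in>sph b Os r. m x)"

definition k_plus :: "('a \<Rightarrow> 'a \<Rightarrow> real) \<Rightarrow> ('a \<Rightarrow> real) \<Rightarrow> 'a set \<Rightarrow> 'a \<Rightarrow> real" where
  "k_plus b m Os x = 1 / m x * (\<Sum>\<^sub>\<infinity>y\<in>sph b Os (radius b Os x + 1). b x y)"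

text \<open>The case distinction is needed because of truncated subtraction: \<open>S(-1)\<close> is empty.\<close>

definition k_minus :: "('a \<Rightarrow> 'a \<Rightarrow> real) \<Rightarrow> ('a \<Rightarrow> real) \<Rightarrow> 'a set \<Rightarrow> 'a \<Rightarrow> real" where
  "k_minus b m Os x =
     (if radius b Os x = 0 then 0
      else 1 / m x * (\<Sum>\<^sub>\<infinity>y\<in>sph b Os (radius b Os x - 1). b x y))"

text \<open>Only meaningful for \<open>|x| \<ge> 1\<close>.\<close>

definition curv_ratio :: "('a \<Rightarrow> 'a \<Rightarrow> real) \<Rightarrow> ('a \<Rightarrow> real) \<Rightarrow> 'a set \<Rightarrow> 'a \<Rightarrow> real" where
  "curv_ratio b m Os x = k_plus b m Os x / k_minus b m Os x"

definition spherically_symmetric :: "('a \<Rightarrow> 'a \<Rightarrow> real) \<Rightarrow> 'a set \<Rightarrow> ('a \<Rightarrow> real) \<Rightarrow> bool" where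
  "spherically_symmetric b Os f \<longleftrightarrow>
     (\<forall>x y. radius b Os x = radius b Os y \<longrightarrow> f x = f y)"

definition weakly_spherically_symmetric ::
    "('a \<Rightarrow> 'a \<Rightarrow> real) \<Rightarrow> ('a \<Rightarrow> real) \<Rightarrow> 'a set \<Rightarrow> bool" where
  "weakly_spherically_symmetric b m Os \<longleftrightarrow>
     spherically_symmetric b Os (k_plus b m Os) \<and> spherically_symmetric b Os (k_minus b m Os)"

text \<open>
  \<open>radial b Os f r\<close> is the value \<open>f(r)\<close> on \<open>S(r)\<close> of a spherically symmetric function \<open>f\<close>.
  The value \<open>0\<close> on an empty sphere is a convention. With it, the hypotheses
  \<open>\<kappa>(1) \<ge> 2\<close> and \<open>\<kappa>(r) \<ge> 1/r + (1 - 1/r) \<kappa>(r-1)\<close> fail as soon as a sphere is empty, i.e.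
  they include that all curvature ratios \<open>\<kappa>(r)\<close>, \<open>r \<ge> 1\<close>, are defined.
\<close>

definition radial :: "('a \<Rightarrow> 'a \<Rightarrow> real) \<Rightarrow> 'a set \<Rightarrow> ('a \<Rightarrow> real) \<Rightarrow> nat \<Rightarrow> real" where
  "radial b Os f r = (if sph b Os r = {} then 0 else f (SOME x. x \<in> sph b Os r))"

abbreviation k_plus_r :: "('a \<Rightarrow> 'a \<Rightarrow> real) \<Rightarrow> ('a \<Rightarrow> real) \<Rightarrow> 'a set \<Rightarrow> nat \<Rightarrow> real" where
  "k_plus_r b m Os \<equiv> radial b Os (k_plus b m Os)"

abbreviation k_minus_r :: "('a \<Rightarrow> 'a \<Rightarrow> real) \<Rightarrow> ('a \<Rightarrow> real) \<Rightarrow> 'a set \<Rightarrow> nat \<Rightarrow> real" where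
  "k_minus_r b m Os \<equiv> radial b Os (k_minus b m Os)"

abbreviation curv_ratio_r :: "('a \<Rightarrow> 'a \<Rightarrow> real) \<Rightarrow> ('a \<Rightarrow> real) \<Rightarrow> 'a set \<Rightarrow> nat \<Rightarrow> real" where
  "curv_ratio_r b m Os \<equiv> radial b Os (curv_ratio b m Os)"


definition hardy_weight :: "('a \<Rightarrow> 'a \<Rightarrow> real) \<Rightarrow> ('a \<Rightarrow> real) \<Rightarrow> ('a \<Rightarrow> real) \<Rightarrow> bool" where
  "hardy_weight b m w \<longleftrightarrow>
     (\<forall>x. w x \<ge> 0) \<and> (\<exists>x. w x \<noteq> 0) \<and> (\<forall>\<phi>\<in>Cc UNIV. energy b \<phi> \<ge> wnorm_sq m w \<phi>)"

definition positive_supersolution ::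
    "('a \<Rightarrow> 'a \<Rightarrow> real) \<Rightarrow> ('a \<Rightarrow> real) \<Rightarrow> ('a \<Rightarrow> real) \<Rightarrow> ('a \<Rightarrow> real) \<Rightarrow> bool" where
  "positive_supersolution b m w u \<longleftrightarrow>
     (\<forall>x. u x > 0) \<and> (\<forall>x. neg_laplacian b m u x - w x * u x \<ge> 0)"

definition agmon_ground_state ::
    "('a \<Rightarrow> 'a \<Rightarrow> real) \<Rightarrow> ('a \<Rightarrow> real) \<Rightarrow> ('a \<Rightarrow> real) \<Rightarrow> ('a \<Rightarrow> real) \<Rightarrow> bool" where
  "agmon_ground_state b m w u \<longleftrightarrow>
     positive_supersolution b m w u \<and>
     (\<forall>v. positive_supersolution b m w v \<longrightarrow> (\<exists>c. \<forall>x. v x = c * u x))"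

definition critical :: "('a \<Rightarrow> 'a \<Rightarrow> real) \<Rightarrow> ('a \<Rightarrow> real) \<Rightarrow> ('a \<Rightarrow> real) \<Rightarrow> bool" where
  "critical b m w \<longleftrightarrow> (\<exists>u. agmon_ground_state b m w u)"

definition null_critical :: "('a \<Rightarrow> 'a \<Rightarrow> real) \<Rightarrow> ('a \<Rightarrow> real) \<Rightarrow> ('a \<Rightarrow> real) \<Rightarrow> bool" where
  "null_critical b m w \<longleftrightarrow>
     critical b m w \<and>
     (\<forall>u. agmon_ground_state b m w u \<longrightarrow>
        (\<Sum>\<^sub>\<infinity>x\<in>UNIV. ennreal ((u x)\<^sup>2 * w x * m x)) = \<infinity>)"

definition optimal_near_infinity :: "('a \<Rightarrow> 'a \<Rightarrow> real) \<Rightarrow> ('a \<Rightarrow> real) \<Rightarrow> ('a \<Rightarrow> real) \<Rightarrow> bool" where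
  "optimal_near_infinity b m w \<longleftrightarrow>
     (\<forall>l>0. \<forall>K. finite K \<longrightarrow>
        (\<exists>\<phi>\<in>Cc (UNIV - K). energy b \<phi> < (1 + l) * wnorm_sq m w \<phi>))"

definition optimal_hardy_weight :: "('a \<Rightarrow> 'a \<Rightarrow> real) \<Rightarrow> ('a \<Rightarrow> real) \<Rightarrow> ('a \<Rightarrow> real) \<Rightarrow> bool" where
  "optimal_hardy_weight b m w \<longleftrightarrow>
     hardy_weight b m w \<and> critical b m w \<and> null_critical b m w \<and> optimal_near_infinity b m w"


text \<open>
  \<open>w\<^sub>\<gamma>\<close> as a function of the radius. It can vanish identically: on the natural numbers with
  \<open>b r (r+1) = r+1\<close>, \<open>m = 1\<close> and \<open>Os = {0}\<close>, one has \<open>\<kappa>(r) = 1 + 1/r\<close>, the only admissible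
  parameter is \<open>\<gamma> = 1\<close>, and \<open>w\<^sub>\<gamma> = 0\<close>. This graph is recurrent and has no Hardy weight.
\<close>

definition w_gamma_r ::
    "('a \<Rightarrow> 'a \<Rightarrow> real) \<Rightarrow> ('a \<Rightarrow> real) \<Rightarrow> 'a set \<Rightarrow> real \<Rightarrow> nat \<Rightarrow> real" where
  "w_gamma_r b m Os \<gamma> r =
     (let kp = k_plus_r b m Os; km = k_minus_r b m Os; \<kappa> = curv_ratio_r b m Os in
      if r = 0 then
        kp 0 * (1 - 1 / sqrt (kp 0 * vol b m Os 0 * \<gamma>))
      else if r = 1 then
        km 1 * (1 + \<kappa> 1 - sqrt (2 * \<kappa> 1) - sqrt (km 1 * vol b m Os 1 * \<gamma>))
      else
        km r * (1 + \<kappa> r - sqrt (\<kappa> r * (1 + 1 / real r))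
                        - sqrt (\<kappa> (r - 1) * (1 - 1 / real r))))"

definition w_gamma ::
    "('a \<Rightarrow> 'a \<Rightarrow> real) \<Rightarrow> ('a \<Rightarrow> real) \<Rightarrow> 'a set \<Rightarrow> real \<Rightarrow> 'a \<Rightarrow> real" where
  "w_gamma b m Os \<gamma> x = w_gamma_r b m Os \<gamma> (radius b Os x)"

end

theory Submission
  imports Defs
begin

text \<open>
  Let \<open>a r\<close> be the total edge weight between \<open>S(r)\<close> and \<open>S(r+1)\<close>. The radial function with
  \<open>u(0) = sqrt \<gamma>\<close> and \<open>u(r) = sqrt (r / a (r-1))\<close> satisfies \<open>-\<Delta>u = w\<^sub>\<gamma> u\<close>, so the ground state
  representation gives the Hardy inequality. Since \<open>\<kappa>\<close> is bounded, \<open>a r u(r) u(r+1)\<close> is \<open>O(r)\<close>, and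
  logarithmic cutoffs of \<open>u\<close> form a null sequence; this gives criticality. Put
  \<open>\<delta>(r) = r \<kappa>(r) - (r+1)\<close>, which is nonnegative and nondecreasing. Then
  \<open>u(r)\<^sup>2 w\<^sub>\<gamma>(r) vol(r)\<close> is bounded below by a multiple of \<open>\<delta>(r)\<^sup>2 / r\<close>, which is not summable
  unless \<open>\<delta>\<close> vanishes identically, and in that case \<open>w\<^sub>\<gamma> = 0\<close>.
\<close>

section \<open>Ground state representation and criticality\<close>

locale locally_finite_weighted_graph = weighted_graph b m
  for b :: "'a \<Rightarrow> 'a \<Rightarrow> real" and m :: "'a \<Rightarrow> real" +
  assumes locally_finite: "locally_finite_graph b"
begin

text \<open>Closing the support under neighbours puts every edge with a nonzero energy term into
  \<open>B\<close>, in both orientations, so the infinite sums become finite double sums over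
  \<open>B\<close>.\<close>

definition covers :: "'a set \<Rightarrow> ('a \<Rightarrow> real) \<Rightarrow> bool" where
  "covers B \<phi> \<longleftrightarrow> finite B \<and> (\<forall>x. \<phi> x \<noteq> 0 \<longrightarrow> x \<in> B \<and> (\<forall>y. b x y > 0 \<longrightarrow> y \<in> B))"

lemma finite_neighbours: "finite {y. b x y > 0}"
  using locally_finite by (simp add: locally_finite_graph_def)

lemma weight_eq_0: "\<not> b x y > 0 \<Longrightarrow> b x y = 0"
  using weight_nonneg[of x y] by simp

text \<open>The set \<open>A\<close> is free so that the endpoints of a prescribed edge can be
  forced into \<open>B\<close>.\<close>

lemma ex_covers:
  assumes "finite {x. \<phi> x \<noteq> 0}" and "finite A"
  shows "\<exists>B. A \<subseteq> B \<and> covers B \<phi>"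
proof (intro exI conjI)
  let ?B = "A \<union> {x. \<phi> x \<noteq> 0} \<union> (\<Union>x\<in>{x. \<phi> x \<noteq> 0}. {y. b x y > 0})"
  show "A \<subseteq> ?B" by blast
  show "covers ?B \<phi>"
    unfolding covers_def using assms finite_neighbours by auto
qed

lemma neg_laplacian_eq_sum:
  assumes "finite B" and "\<And>y. b x y > 0 \<Longrightarrow> y \<in> B"
  shows "m x * neg_laplacian b m f x = (\<Sum>y\<in>B. b x y * (f x - f y))"
proof -
  have "(\<Sum>\<^sub>\<infinity>y\<in>UNIV. b x y * (f x - f y)) = (\<Sum>\<^sub>\<infinity>y\<in>B. b x y * (f x - f y))"
    by (rule infsum_cong_neutral) (use assms(2) weight_eq_0 in auto)
  then show ?thesis
    using assms(1) measure_pos[of x] by (simp add: neg_laplacian_def)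
qed

lemma energy_eq_sum:
  assumes "covers B \<phi>"
  shows "energy b \<phi> = 1/2 * (\<Sum>x\<in>B. \<Sum>y\<in>B. b x y * (\<phi> x - \<phi> y)\<^sup>2)"
proof -
  have zero: "b x y * (\<phi> x - \<phi> y)\<^sup>2 = 0" if "x \<notin> B \<or> y \<notin> B" for x y
  proof (cases "b x y > 0")
    case True
    moreover have "b y x > 0" using True weight_sym by metis
    ultimately have "\<phi> x = 0" "\<phi> y = 0"
      using assms that unfolding covers_def by blast+
    then show ?thesis by simp
  qed (simp add: weight_eq_0)
  have "(\<Sum>\<^sub>\<infinity>(x, y)\<in>UNIV. b x y * (\<phi> x - \<phi> y)\<^sup>2)
      = (\<Sum>\<^sub>\<infinity>(x, y)\<in>B \<times> B. b x y * (\<phi> x - \<phi> y)\<^sup>2)"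
  proof (rule infsum_cong_neutral)
    fix p assume "p \<in> UNIV - B \<times> B"
    then show "(case p of (x, y) \<Rightarrow> b x y * (\<phi> x - \<phi> y)\<^sup>2) = 0"
      by (cases p) (simp only: mem_Times_iff, simp only: prod.case fst_conv snd_conv, rule zero, simp)
  qed auto
  also have "\<dots> = (\<Sum>(x, y)\<in>B \<times> B. b x y * (\<phi> x - \<phi> y)\<^sup>2)"
    using assms by (simp add: covers_def)
  also have "\<dots> = (\<Sum>x\<in>B. \<Sum>y\<in>B. b x y * (\<phi> x - \<phi> y)\<^sup>2)"
    by (simp add: sum.cartesian_product)
  finally show ?thesis by (simp add: energy_def)
qed

lemma wnorm_sq_eq_sum:
  assumes "covers B \<phi>"
  shows "wnorm_sq m w \<phi> = (\<Sum>x\<in>B. w x * (\<phi> x)\<^sup>2 * m x)"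
proof -
  have "wnorm_sq m w \<phi> = (\<Sum>\<^sub>\<infinity>x\<in>B. w x * (\<phi> x)\<^sup>2 * m x)"
    unfolding wnorm_sq_def
    by (rule infsum_cong_neutral) (use assms in \<open>auto simp: covers_def\<close>)
  then show ?thesis using assms by (simp add: covers_def)
qed

section \<open>The ground state transform of the energy\<close>

definition ground_state_form :: "'a set \<Rightarrow> ('a \<Rightarrow> real) \<Rightarrow> ('a \<Rightarrow> real) \<Rightarrow> real" where
  "ground_state_form B v \<phi> =
     1/2 * (\<Sum>x\<in>B. \<Sum>y\<in>B. b x y * v x * v y * (\<phi> x / v x - \<phi> y / v y)\<^sup>2)"

text \<open>The squared difference equals its transformed counterpart plus the cross terms
  \<open>T x y\<close> and \<open>T y x\<close>. Both have the same total over \<open>B\<close>, and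
  summing \<open>T x y\<close> over \<open>y\<close> produces the Laplacian of \<open>v\<close>. No
  equation for \<open>v\<close> is required: the quotient \<open>neg_laplacian b m v x / v x\<close>
  acts as the potential.\<close>

lemma ground_state_representation:
  assumes B: "covers B \<phi>" and v: "\<And>x. v x > 0"
  shows "energy b \<phi> = ground_state_form B v \<phi>
    + wnorm_sq m (\<lambda>x. neg_laplacian b m v x / v x) \<phi>"
proof -
  define T where "T x y = (\<phi> x)\<^sup>2 / v x * (b x y * (v x - v y))" for x y
  have split: "b x y * (\<phi> x - \<phi> y)\<^sup>2
      = b x y * v x * v y * (\<phi> x / v x - \<phi> y / v y)\<^sup>2 + (T x y + T y x)" for x y
    using v[of x] v[of y] unfolding T_def weight_sym[of y x]
    by (simp add: field_simps power2_eq_square)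
  have "(\<Sum>x\<in>B. \<Sum>y\<in>B. b x y * (\<phi> x - \<phi> y)\<^sup>2)
     = 2 * ground_state_form B v \<phi> + ((\<Sum>x\<in>B. \<Sum>y\<in>B. T x y) + (\<Sum>x\<in>B. \<Sum>y\<in>B. T y x))"
    unfolding split ground_state_form_def by (simp add: sum.distrib)
  also have "(\<Sum>x\<in>B. \<Sum>y\<in>B. T y x) = (\<Sum>x\<in>B. \<Sum>y\<in>B. T x y)"
    by (rule sum.swap)
  also have "(\<Sum>x\<in>B. \<Sum>y\<in>B. T x y)
      = (\<Sum>x\<in>B. neg_laplacian b m v x / v x * (\<phi> x)\<^sup>2 * m x)"
  proof (rule sum.cong)
    fix x assume "x \<in> B"
    show "(\<Sum>y\<in>B. T x y) = neg_laplacian b m v x / v x * (\<phi> x)\<^sup>2 * m x"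
    \<comment> \<open>Only vertices of the support are known to have all their neighbours in
      \<open>B\<close>; elsewhere both sides vanish.\<close>
    proof (cases "\<phi> x = 0")
      case False
      then have "m x * neg_laplacian b m v x = (\<Sum>y\<in>B. b x y * (v x - v y))"
        using B by (intro neg_laplacian_eq_sum) (auto simp: covers_def)
      then have "(\<Sum>y\<in>B. T x y) = (\<phi> x)\<^sup>2 / v x * (m x * neg_laplacian b m v x)"
        unfolding T_def by (simp only: sum_distrib_left)
      then show ?thesis by simp
    qed (simp add: T_def)
  qed simp
  finally show ?thesis
    by (simp add: energy_eq_sum[OF B] wnorm_sq_eq_sum[OF B])
qed

lemma wnorm_sq_mono:
  assumes "finite {x. \<phi> x \<noteq> 0}" and "\<And>x. w x \<le> w' x"
  shows "wnorm_sq m w \<phi> \<le> wnorm_sq m w' \<phi>"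
proof -
  obtain B where B: "covers B \<phi>" using ex_covers[OF assms(1) finite.emptyI] by blast
  show ?thesis
    unfolding wnorm_sq_eq_sum[OF B]
    by (intro sum_mono mult_right_mono) (use assms(2) measure_pos in \<open>auto intro: less_imp_le\<close>)
qed

lemma ground_state_form_nonneg:
  assumes "\<And>x. v x > 0"
  shows "ground_state_form B v \<phi> \<ge> 0"
  unfolding ground_state_form_def
  using assms weight_nonneg by (intro mult_nonneg_nonneg sum_nonneg) (auto intro: less_imp_le)

text \<open>One oriented edge is kept from a double sum of nonnegative terms. This lets smallness of
  the form control the variation of \<open>\<phi> / v\<close> along a single edge.\<close>

lemma ground_state_form_ge_edge:
  assumes "finite B" "x \<in> B" "y \<in> B" "\<And>x. v x > 0"
  shows "ground_state_form B v \<phi> \<ge> 1/2 * (b x y * v x * v y * (\<phi> x / v x - \<phi> y / v y)\<^sup>2)"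
proof -
  let ?F = "\<lambda>x y. b x y * v x * v y * (\<phi> x / v x - \<phi> y / v y)\<^sup>2"
  have nn: "?F x y \<ge> 0" for x y
    using assms(4) weight_nonneg by (intro mult_nonneg_nonneg) (auto intro: less_imp_le)
  have "?F x y \<le> (\<Sum>y\<in>B. ?F x y)"
    using assms nn by (intro member_le_sum) auto
  also have "\<dots> \<le> (\<Sum>x\<in>B. \<Sum>y\<in>B. ?F x y)"
    using assms nn by (intro member_le_sum[where f = "\<lambda>x. \<Sum>y\<in>B. ?F x y"] sum_nonneg) auto
  finally show ?thesis unfolding ground_state_form_def by simp
qed

text \<open>A supersolution for \<open>w\<close> is an exact solution for the potential
  \<open>neg_laplacian b m v x / v x\<close>, which dominates \<open>w\<close>.\<close>

lemma energy_ge_supersolution: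
  assumes fin: "finite {x. \<phi> x \<noteq> 0}" and B: "covers B \<phi>"
    and v: "positive_supersolution b m w v"
  shows "energy b \<phi> - wnorm_sq m w \<phi> \<ge> ground_state_form B v \<phi>"
proof -
  have pos: "\<And>x. v x > 0" and super: "\<And>x. w x * v x \<le> neg_laplacian b m v x"
    using v by (auto simp: positive_supersolution_def)
  have "w x \<le> neg_laplacian b m v x / v x" for x
    using super[of x] pos[of x] by (simp add: pos_le_divide_eq)
  then have "wnorm_sq m w \<phi> \<le> wnorm_sq m (\<lambda>x. neg_laplacian b m v x / v x) \<phi>"
    by (intro wnorm_sq_mono fin)
  then show ?thesis
    using ground_state_representation[OF B, of v] pos by simp
qed

lemma hardy_inequality:
  assumes "finite {x. \<phi> x \<noteq> 0}" and "positive_supersolution b m w v"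
  shows "energy b \<phi> \<ge> wnorm_sq m w \<phi>"
proof -
  obtain B where B: "covers B \<phi>" using ex_covers[OF assms(1) finite.emptyI] by blast
  have "ground_state_form B v \<phi> \<ge> 0"
    using assms(2) by (intro ground_state_form_nonneg) (simp add: positive_supersolution_def)
  then show ?thesis using energy_ge_supersolution[OF assms(1) B assms(2)] by simp
qed

text \<open>The sequence \<open>\<phi>\<close> is a null sequence for the form. By the ground state representation
  with respect to a competing supersolution \<open>v\<close>, the quotient \<open>u / v\<close> has no
  variation along edges.\<close>

lemma agmon_ground_stateI:
  assumes conn: "connected_graph b"
    and u: "positive_supersolution b m w u"
    and supp: "\<And>n. finite {x. \<phi> n x \<noteq> 0}"
    and lim: "\<And>x. (\<lambda>n. \<phi> n x) \<longlonglongrightarrow> u x"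
    and null: "(\<lambda>n. energy b (\<phi> n) - wnorm_sq m w (\<phi> n)) \<longlonglongrightarrow> 0"
  shows "agmon_ground_state b m w u"
  unfolding agmon_ground_state_def
proof (intro conjI allI impI u)
  fix v assume v: "positive_supersolution b m w v"
  have upos: "u x > 0" and vpos: "v x > 0" for x
    using u v by (auto simp: positive_supersolution_def)
  have edge: "u x / v x = u y / v y" if "b x y > 0" for x y
  proof -
    let ?F = "\<lambda>f. 1/2 * (b x y * v x * v y * (f x / v x - f y / v y)\<^sup>2)"
    have "?F (\<phi> n) \<le> energy b (\<phi> n) - wnorm_sq m w (\<phi> n)" for n
    proof -
      obtain B where B: "{x, y} \<subseteq> B" "covers B (\<phi> n)"
        using ex_covers[OF supp, of "{x, y}"] by blast
      show ?thesis
        using ground_state_form_ge_edge[of B x y v "\<phi> n"] B vpos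
          energy_ge_supersolution[OF supp B(2) v] by (auto simp: covers_def)
    qed
    moreover have "(\<lambda>n. ?F (\<phi> n)) \<longlonglongrightarrow> ?F u"
      using vpos[of x] vpos[of y] by (intro tendsto_intros lim) auto
    ultimately have "?F u \<le> 0"
      using null by (intro LIMSEQ_le) auto
    then show ?thesis
      using that vpos[of x] vpos[of y]
      by (auto simp: mult_le_0_iff zero_le_mult_iff not_le)
  qed
  have const: "u x / v x = u y / v y" for x y
  proof -
    have "(x, y) \<in> (edges b)\<^sup>*" using conn by (simp add: connected_graph_def)
    then show ?thesis
      by (induction rule: rtrancl_induct) (use edge in \<open>auto simp: edges_def\<close>)
  qed
  show "\<exists>c. \<forall>x. v x = c * u x"
  proof (intro exI allI)
    fix x
    \<comment> \<open>The vertex \<open>undefined\<close> serves as an arbitrary base point; any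
      vertex would do.\<close>
    show "v x = (v undefined / u undefined) * u x"
      using const[of x undefined] upos[of undefined] vpos[of x] vpos[of undefined]
      by (simp add: field_simps)
  qed
qed

section \<open>Testing null-criticality on one ground state\<close>

lemma agmon_ground_state_unique:
  assumes "agmon_ground_state b m w u" "agmon_ground_state b m w u'"
  shows "\<exists>c>0. \<forall>x. u' x = c * u x"
proof -
  have "\<exists>c. \<forall>x. u' x = c * u x"
    using assms unfolding agmon_ground_state_def by simp
  then obtain c where c: "\<forall>x. u' x = c * u x" ..
  have "u undefined > 0" "u' undefined > 0"
    using assms by (auto simp: agmon_ground_state_def positive_supersolution_def)
  moreover have "u' undefined = c * u undefined" using c ..
  ultimately have "c > 0" by (simp add: zero_less_mult_iff)
  with c show ?thesis by (intro exI conjI)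
qed

text \<open>Ground states differ by positive factors, so divergence for \<open>u\<close> gives
  divergence for all of them. As the terms are nonnegative, it suffices that the finite partial sums
  are unbounded.\<close>

lemma null_criticalI:
  assumes u: "agmon_ground_state b m w u" and w: "\<And>x. w x \<ge> 0"
    and unbounded: "\<And>M. \<exists>F. finite F \<and> (\<Sum>x\<in>F. (u x)\<^sup>2 * w x * m x) \<ge> M"
  shows "null_critical b m w"
  unfolding null_critical_def
proof (intro conjI allI impI)
  show "critical b m w" using u by (auto simp: critical_def)
  fix u' assume "agmon_ground_state b m w u'"
  with u have "\<exists>c>0. \<forall>x. u' x = c * u x"
    by (rule agmon_ground_state_unique)
  then obtain c where c: "c > 0" and u': "\<forall>x. u' x = c * u x"
    by (elim exE conjE)
  let ?f = "\<lambda>x. (u' x)\<^sup>2 * w x * m x"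
  have nn: "?f x \<ge> 0" for x
    using w measure_pos by (simp add: less_imp_le)
  show "(\<Sum>\<^sub>\<infinity>x\<in>UNIV. ennreal (?f x)) = \<infinity>"
  proof (rule ccontr)
    assume "\<not> ?thesis"
    then obtain M where M: "M \<ge> 0" "(\<Sum>\<^sub>\<infinity>x\<in>UNIV. ennreal (?f x)) = ennreal M"
      by (cases "\<Sum>\<^sub>\<infinity>x\<in>UNIV. ennreal (?f x)") simp_all
    \<comment> \<open>After scaling by the square of \<open>c\<close>, this partial sum exceeds the
      supposed total \<open>M\<close>.\<close>
    obtain F where F: "finite F" "(\<Sum>x\<in>F. (u x)\<^sup>2 * w x * m x) \<ge> (M + 1) / c\<^sup>2"
      using unbounded by blast
    have "(\<Sum>x\<in>F. ?f x) = c\<^sup>2 * (\<Sum>x\<in>F. (u x)\<^sup>2 * w x * m x)"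
      unfolding sum_distrib_left by (simp only: u'[rule_format] power_mult_distrib mult.assoc)
    also have "\<dots> \<ge> M + 1"
      using F(2) c by (simp add: pos_divide_le_eq mult.commute)
    finally have "M + 1 \<le> (\<Sum>x\<in>F. ?f x)" .
    moreover have "ennreal (\<Sum>x\<in>F. ?f x) \<le> ennreal M"
    proof -
      have "ennreal (\<Sum>x\<in>F. ?f x) = (\<Sum>\<^sub>\<infinity>x\<in>F. ennreal (?f x))"
        using sum_ennreal[of F ?f, OF nn] F(1) by simp
      also have "\<dots> \<le> (\<Sum>\<^sub>\<infinity>x\<in>UNIV. ennreal (?f x))"
        by (rule infsum_mono_neutral; (rule nonneg_summable_on_complete)?; simp)
      finally show ?thesis unfolding M(2) .
    qed
    ultimately show False using M(1) by (simp only: ennreal_le_iff)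
  qed
qed

end

section \<open>Weakly spherically symmetric graphs\<close>

locale weakly_spherical_graph = locally_finite_weighted_graph b m
  for b :: "'a \<Rightarrow> 'a \<Rightarrow> real" and m :: "'a \<Rightarrow> real" +
  fixes Os :: "'a set"
  assumes connected: "connected_graph b"
    and finite_Os: "finite Os" and Os_nonempty: "Os \<noteq> {}"
    and weakly_spherical: "weakly_spherically_symmetric b m Os"
begin

section \<open>Distance spheres\<close>

abbreviation "rad \<equiv> radius b Os"
abbreviation "S \<equiv> sph b Os"
abbreviation "ball_vertices N \<equiv> {x. rad x \<le> N}"

lemma radius_le:
  assumes "z \<in> Os" "(x, z) \<in> edges b ^^ n"
  shows "rad x \<le> n"
proof -
  have "rad x \<le> graph_dist b x z"
    using assms finite_Os by (simp add: radius_def)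
  also have "\<dots> \<le> n"
    unfolding graph_dist_def using assms by (intro Least_le)
  finally show ?thesis .
qed

text \<open>Connectedness provides a path for \<open>LEAST\<close> to choose from, and
  \<open>Min\<close> is attained because \<open>Os\<close> is finite and nonempty.\<close>

lemma radius_attained:
  obtains z where "z \<in> Os" "(x, z) \<in> edges b ^^ rad x"
proof -
  have "rad x \<in> graph_dist b x ` Os"
    unfolding radius_def using finite_Os Os_nonempty by (intro Min_in) auto
  then obtain z where z: "z \<in> Os" "rad x = graph_dist b x z" by blast
  have "\<exists>n. (x, z) \<in> edges b ^^ n"
    using connected by (simp add: connected_graph_def rtrancl_power)
  then have "(x, z) \<in> edges b ^^ graph_dist b x z"
    unfolding graph_dist_def by (rule LeastI_ex)
  with z that show ?thesis by metis
qed

lemma radius_le_Suc: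
  assumes "b x y > 0"
  shows "rad x \<le> Suc (rad y)"
proof -
  obtain z where z: "z \<in> Os" "(y, z) \<in> edges b ^^ rad y" by (rule radius_attained)
  have "(x, y) \<in> edges b" using assms by (simp add: edges_def)
  then have "(x, z) \<in> edges b ^^ Suc (rad y)" using z(2) by (rule relpow_Suc_I2)
  then show ?thesis using z(1) radius_le by blast
qed

lemma weight_eq_0_radius:
  assumes "Suc (rad x) < rad y"
  shows "b x y = 0" "b y x = 0"
proof -
  have "\<not> b y x > 0" using radius_le_Suc[of y x] assms by auto
  then show "b y x = 0" by (rule weight_eq_0)
  then show "b x y = 0" by (simp add: weight_sym)
qed

text \<open>The first step of a shortest path to \<open>Os\<close> leads to the previous
  sphere.\<close>

lemma ex_inward_neighbour:
  assumes "rad x = Suc r"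
  obtains y where "b x y > 0" "rad y = r"
proof -
  obtain z where z: "z \<in> Os" "(x, z) \<in> edges b ^^ Suc r"
    using radius_attained[of x] assms by metis
  from z(2) obtain y where y: "(x, y) \<in> edges b" "(y, z) \<in> edges b ^^ r"
    by (rule relpow_Suc_E2)
  then have "b x y > 0" "rad y \<le> r" using z(1) radius_le by (auto simp: edges_def)
  moreover from this have "rad y \<ge> r" using radius_le_Suc[of x y] assms by simp
  ultimately show ?thesis using that by simp
qed

text \<open>The innermost sphere lies in \<open>Os\<close>, and each later one consists of
  neighbours of its predecessor, of which there are finitely many by local finiteness.\<close>

lemma finite_sphere: "finite (S r)"
proof (induction r)
  case 0
  have "S 0 \<subseteq> Os"
  proof
    fix x assume "x \<in> S 0"
    then have "rad x = 0" by (simp add: sph_def)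
    then show "x \<in> Os" using radius_attained[of x] by auto
  qed
  then show ?case using finite_Os finite_subset by blast
next
  case (Suc r)
  have "S (Suc r) \<subseteq> (\<Union>y\<in>S r. {x. b y x > 0})"
  proof
    fix x assume "x \<in> S (Suc r)"
    then obtain y where "b x y > 0" "rad y = r"
      using ex_inward_neighbour[of x r] by (auto simp: sph_def)
    then show "x \<in> (\<Union>y\<in>S r. {x. b y x > 0})"
      by (auto simp: sph_def weight_sym)
  qed
  moreover have "finite (\<Union>y\<in>S r. {x. b y x > 0})"
    using Suc finite_neighbours by simp
  ultimately show ?case by (rule finite_subset)
qed

lemma ball_vertices_0: "ball_vertices 0 = S 0"
  by (auto simp: sph_def)

lemma ball_vertices_Suc: "ball_vertices (Suc N) = ball_vertices N \<union> S (Suc N)"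
  by (auto simp: sph_def)

lemma finite_ball_vertices: "finite (ball_vertices N)"
  by (induction N) (simp_all only: ball_vertices_0 ball_vertices_Suc finite_sphere finite_Un)

lemma sum_ball_vertices: "(\<Sum>x\<in>ball_vertices N. f x) = (\<Sum>r\<le>N. \<Sum>x\<in>S r. f x :: real)"
proof (induction N)
  case (Suc N)
  have "ball_vertices N \<inter> S (Suc N) = {}" by (auto simp: sph_def)
  then show ?case
    unfolding ball_vertices_Suc
    using Suc finite_ball_vertices finite_sphere by (simp add: sum.union_disjoint)
qed (simp only: ball_vertices_0, simp)

section \<open>Edge weight between consecutive spheres\<close>

definition flux :: "nat \<Rightarrow> real" where
  "flux r = (\<Sum>x\<in>S r. \<Sum>y\<in>S (Suc r). b x y)"

lemma mult_k_plus: "m x * k_plus b m Os x = (\<Sum>y\<in>S (Suc (rad x)). b x y)"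
  using measure_pos[of x] finite_sphere by (simp add: k_plus_def)

lemma mult_k_minus:
  assumes "rad x = Suc r"
  shows "m x * k_minus b m Os x = (\<Sum>y\<in>S r. b x y)"
  using measure_pos[of x] finite_sphere assms by (simp add: k_minus_def)

lemma radial_radius:
  assumes "spherically_symmetric b Os f"
  shows "radial b Os f (rad x) = f x"
proof -
  let ?y = "SOME y. y \<in> S (rad x)"
  have x: "x \<in> S (rad x)" by (simp add: sph_def)
  then have "?y \<in> S (rad x)" by (rule someI)
  then have "rad ?y = rad x" by (simp add: sph_def)
  then have "f ?y = f x"
    using assms unfolding spherically_symmetric_def by blast
  moreover have "S (rad x) \<noteq> {}" using x by blast
  ultimately show ?thesis by (simp add: radial_def)
qed

lemma spherical_k:
  "spherically_symmetric b Os (k_plus b m Os)" "spherically_symmetric b Os (k_minus b m Os)"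
  "spherically_symmetric b Os (curv_ratio b m Os)"
proof -
  show plus: "spherically_symmetric b Os (k_plus b m Os)"
    and minus: "spherically_symmetric b Os (k_minus b m Os)"
    using weakly_spherical by (simp_all add: weakly_spherically_symmetric_def)
  show "spherically_symmetric b Os (curv_ratio b m Os)"
    unfolding spherically_symmetric_def curv_ratio_def
  proof (intro allI impI)
    fix x y assume "rad x = rad y"
    then have "k_plus b m Os x = k_plus b m Os y" "k_minus b m Os x = k_minus b m Os y"
      by (rule plus[unfolded spherically_symmetric_def, rule_format],
          rule minus[unfolded spherically_symmetric_def, rule_format])
    then show "k_plus b m Os x / k_minus b m Os x = k_plus b m Os y / k_minus b m Os y"
      by simp
  qed
qed

lemma vol_eq_sum: "vol b m Os r = (\<Sum>x\<in>S r. m x)"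
  by (simp add: vol_def finite_sphere)

lemma vol_pos: "S r \<noteq> {} \<Longrightarrow> vol b m Os r > 0"
  unfolding vol_eq_sum using finite_sphere measure_pos by (intro sum_pos) auto

text \<open>By weak spherical symmetry the outward edge weight of a vertex is a fixed multiple of
  its measure, although \<open>m\<close> itself need not be radial. Counting the same edges from the
  outer sphere gives the companion formula with \<open>k_minus\<close>.\<close>

lemma flux_eq_k_plus: "flux r = k_plus_r b m Os r * vol b m Os r"
proof -
  have "(\<Sum>y\<in>S (Suc r). b x y) = k_plus_r b m Os r * m x" if "x \<in> S r" for x
    using that mult_k_plus[of x] radial_radius[OF spherical_k(1), of x]
    by (simp add: sph_def mult.commute)
  then show ?thesis by (simp add: flux_def vol_eq_sum sum_distrib_left)
qed

lemma flux_eq_k_minus: "flux r = k_minus_r b m Os (Suc r) * vol b m Os (Suc r)"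
proof -
  have "(\<Sum>x\<in>S r. b x y) = k_minus_r b m Os (Suc r) * m y" if "y \<in> S (Suc r)" for y
    using that mult_k_minus[of y r] radial_radius[OF spherical_k(2), of y]
    by (simp add: sph_def mult.commute weight_sym)
  moreover have "flux r = (\<Sum>y\<in>S (Suc r). \<Sum>x\<in>S r. b x y)"
    unfolding flux_def by (rule sum.swap)
  ultimately show ?thesis by (simp add: vol_eq_sum sum_distrib_left)
qed

lemma flux_pos:
  assumes "S (Suc r) \<noteq> {}"
  shows "flux r > 0"
proof -
  obtain x where x: "rad x = Suc r" using assms by (auto simp: sph_def)
  obtain y where y: "b x y > 0" "rad y = r" using ex_inward_neighbour[OF x] by blast
  have "0 < (\<Sum>x\<in>S (Suc r). b y x)"
    using x y by (intro sum_pos2[where i = x] finite_sphere weight_nonneg)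
      (auto simp: sph_def weight_sym)
  then show ?thesis
    unfolding flux_def using y(2)
    by (intro sum_pos2[where i = y and f = "\<lambda>x. \<Sum>y\<in>S (Suc r). b x y"]
        finite_sphere sum_nonneg weight_nonneg) (auto simp: sph_def)
qed

section \<open>The Laplacian and the quadratic forms on radial functions\<close>

lemma neg_laplacian_radial_0:
  assumes "rad x = 0"
  shows "neg_laplacian b m (\<lambda>z. f (rad z)) x = k_plus_r b m Os 0 * (f 0 - f 1)"
proof -
  have "m x * neg_laplacian b m (\<lambda>z. f (rad z)) x
      = (\<Sum>y\<in>S 0 \<union> S 1. b x y * (f (rad x) - f (rad y)))"
  proof (rule neg_laplacian_eq_sum)
    fix y assume "b x y > 0"
    then have "rad y \<le> 1" using radius_le_Suc[of y x] assms by (simp add: weight_sym)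
    then show "y \<in> S 0 \<union> S 1" by (auto simp: sph_def)
  qed (simp add: finite_sphere)
  also have "\<dots> = (\<Sum>y\<in>S 0. b x y * (f (rad x) - f (rad y)))
      + (\<Sum>y\<in>S 1. b x y * (f (rad x) - f (rad y)))"
    by (intro sum.union_disjoint finite_sphere) (auto simp: sph_def)
  also have "(\<Sum>y\<in>S 0. b x y * (f (rad x) - f (rad y))) = 0"
    using assms by (intro sum.neutral) (auto simp: sph_def)
  also have "(\<Sum>y\<in>S 1. b x y * (f (rad x) - f (rad y))) = (\<Sum>y\<in>S 1. b x y) * (f 0 - f 1)"
    unfolding sum_distrib_right using assms by (intro sum.cong) (auto simp: sph_def)
  also have "(\<Sum>y\<in>S 1. b x y) = m x * k_plus_r b m Os 0"
    using mult_k_plus[of x] radial_radius[OF spherical_k(1), of x] assms by simp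
  finally show ?thesis using measure_pos[of x] by simp
qed

text \<open>Neighbours lie in three consecutive spheres. A radial function is constant on each
  sphere, so edges inside a sphere drop out and only \<open>k_plus\<close> and
  \<open>k_minus\<close> remain.\<close>

lemma neg_laplacian_radial_Suc:
  assumes "rad x = Suc r"
  shows "neg_laplacian b m (\<lambda>z. f (rad z)) x =
    k_plus_r b m Os (Suc r) * (f (Suc r) - f (Suc (Suc r)))
    + k_minus_r b m Os (Suc r) * (f (Suc r) - f r)"
proof -
  let ?g = "\<lambda>y. b x y * (f (rad x) - f (rad y))"
  have "m x * neg_laplacian b m (\<lambda>z. f (rad z)) x
      = sum ?g (S (Suc r) \<union> (S r \<union> S (Suc (Suc r))))"
  proof (rule neg_laplacian_eq_sum)
    fix y assume "b x y > 0"
    then have "rad y \<le> Suc (Suc r)" "r \<le> rad y"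
      using radius_le_Suc[of y x] radius_le_Suc[of x y] assms by (simp_all add: weight_sym)
    then show "y \<in> S (Suc r) \<union> (S r \<union> S (Suc (Suc r)))" by (auto simp: sph_def)
  qed (simp add: finite_sphere)
  also have "\<dots> = sum ?g (S (Suc r)) + sum ?g (S r \<union> S (Suc (Suc r)))"
    by (intro sum.union_disjoint finite_UnI finite_sphere) (auto simp: sph_def)
  also have "sum ?g (S r \<union> S (Suc (Suc r))) = sum ?g (S r) + sum ?g (S (Suc (Suc r)))"
    by (intro sum.union_disjoint finite_sphere) (auto simp: sph_def)
  also have "sum ?g (S (Suc r)) = 0"
    using assms by (intro sum.neutral) (auto simp: sph_def)
  also have "sum ?g (S r) = (\<Sum>y\<in>S r. b x y) * (f (Suc r) - f r)"
    unfolding sum_distrib_right using assms by (intro sum.cong) (auto simp: sph_def)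
  also have "(\<Sum>y\<in>S r. b x y) = m x * k_minus_r b m Os (Suc r)"
    using mult_k_minus[OF assms] radial_radius[OF spherical_k(2), of x] assms by simp
  also have "sum ?g (S (Suc (Suc r)))
      = (\<Sum>y\<in>S (Suc (Suc r)). b x y) * (f (Suc r) - f (Suc (Suc r)))"
    unfolding sum_distrib_right using assms by (intro sum.cong) (auto simp: sph_def)
  also have "(\<Sum>y\<in>S (Suc (Suc r)). b x y) = m x * k_plus_r b m Os (Suc r)"
    using mult_k_plus[of x] radial_radius[OF spherical_k(1), of x] assms by simp
  finally have "m x * neg_laplacian b m (\<lambda>z. f (rad z)) x = m x *
    (k_plus_r b m Os (Suc r) * (f (Suc r) - f (Suc (Suc r)))
    + k_minus_r b m Os (Suc r) * (f (Suc r) - f r))"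
    by (simp add: algebra_simps)
  then show ?thesis using measure_pos[of x] by simp
qed

text \<open>Induction on the radius: a new sphere is joined to the ball only through
  \<open>S N\<close>, its inner edges contribute nothing, and the two orientations give the factor
  2.\<close>

lemma sum_radial_edges:
  assumes sym: "\<And>r s. G r s = G s r" and diag: "\<And>r. G r r = (0::real)"
  shows "(\<Sum>x\<in>ball_vertices N. \<Sum>y\<in>ball_vertices N. b x y * G (rad x) (rad y))
    = 2 * (\<Sum>r<N. flux r * G r (Suc r))"
proof (induction N)
  case 0
  have "(\<Sum>x\<in>S 0. \<Sum>y\<in>S 0. b x y * G (rad x) (rad y)) = 0"
    using diag by (intro sum.neutral ballI) (auto simp: sph_def)
  then show ?case by (simp only: ball_vertices_0) simp
next
  case (Suc N)
  let ?B = "ball_vertices N" and ?S = "S (Suc N)"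
  let ?g = "\<lambda>x y. b x y * G (rad x) (rad y)"
  have disj: "?B \<inter> ?S = {}" by (auto simp: sph_def)
  have split: "sum f (?B \<union> ?S) = sum f ?B + sum f ?S" for f :: "'a \<Rightarrow> real"
    by (intro sum.union_disjoint finite_ball_vertices finite_sphere disj)
  have diag0: "(\<Sum>x\<in>?S. \<Sum>y\<in>?S. ?g x y) = 0"
    using diag by (intro sum.neutral ballI) (auto simp: sph_def)
  have "(\<Sum>x\<in>?S. \<Sum>y\<in>?B. ?g x y) = (\<Sum>y\<in>?B. \<Sum>x\<in>?S. ?g x y)"
    by (rule sum.swap)
  also have "\<dots> = (\<Sum>x\<in>?B. \<Sum>y\<in>?S. ?g x y)"
    by (intro sum.cong refl arg_cong2[of _ _ _ _ "(*)"] weight_sym sym)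
  finally have swap: "(\<Sum>x\<in>?S. \<Sum>y\<in>?B. ?g x y) = (\<Sum>x\<in>?B. \<Sum>y\<in>?S. ?g x y)" .
  \<comment> \<open>Edges cannot skip a sphere, so vertices of radius below \<open>N\<close> have no
    neighbours in the new sphere.\<close>
  have "(\<Sum>x\<in>?B. \<Sum>y\<in>?S. ?g x y) = (\<Sum>x\<in>S N. \<Sum>y\<in>?S. ?g x y)"
    by (rule sum.mono_neutral_right)
       (auto simp: sph_def finite_ball_vertices weight_eq_0_radius intro!: sum.neutral)
  also have "\<dots> = (\<Sum>x\<in>S N. \<Sum>y\<in>?S. b x y * G N (Suc N))"
    by (intro sum.cong) (auto simp: sph_def)
  also have "\<dots> = flux N * G N (Suc N)"
    by (simp add: flux_def sum_distrib_right)
  finally have "(\<Sum>x\<in>?B. \<Sum>y\<in>?S. ?g x y) = flux N * G N (Suc N)" .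
  then show ?case
    unfolding ball_vertices_Suc split sum.distrib swap diag0 Suc by simp
qed

text \<open>The function vanishes already on \<open>S N\<close>, so the neighbours of its support
  still have radius at most \<open>N\<close>.\<close>

lemma covers_ball_vertices:
  assumes "\<And>x. N \<le> rad x \<Longrightarrow> \<phi> x = 0"
  shows "covers (ball_vertices N) \<phi>"
  unfolding covers_def
proof (intro conjI allI impI finite_ball_vertices)
  fix x assume "\<phi> x \<noteq> 0"
  then have x: "rad x < N" using assms[of x] by (meson not_le)
  then show "x \<in> ball_vertices N" by simp
  fix y assume "b x y > 0"
  then show "y \<in> ball_vertices N" using radius_le_Suc[of y x] x by (simp add: weight_sym)
qed

text \<open>On radial functions the transformed energy is that of a path on the natural numbers with
  edge weights \<open>flux r * U r * U (Suc r)\<close>.\<close>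

lemma ground_state_form_radial:
  assumes "\<And>r. U r > 0"
  shows "ground_state_form (ball_vertices N) (\<lambda>x. U (rad x)) (\<lambda>x. U (rad x) * f (rad x))
    = (\<Sum>r<N. flux r * U r * U (Suc r) * (f r - f (Suc r))\<^sup>2)"
proof -
  have nz: "U r \<noteq> 0" for r using assms[of r] by simp
  have "(\<Sum>x\<in>ball_vertices N. \<Sum>y\<in>ball_vertices N.
        b x y * (U (rad x) * U (rad y) * (f (rad x) - f (rad y))\<^sup>2))
      = 2 * (\<Sum>r<N. flux r * (U r * U (Suc r) * (f r - f (Suc r))\<^sup>2))"
    by (rule sum_radial_edges) (simp_all add: power2_commute mult_ac)
  then show ?thesis by (simp add: ground_state_form_def nz mult.assoc)
qed

lemma wnorm_sq_radial:
  assumes "\<And>r. N \<le> r \<Longrightarrow> f r = 0"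
  shows "wnorm_sq m (\<lambda>x. W (rad x)) (\<lambda>x. U (rad x) * f (rad x))
    = (\<Sum>r\<le>N. (f r)\<^sup>2 * ((U r)\<^sup>2 * W r * vol b m Os r))"
proof -
  have "covers (ball_vertices N) (\<lambda>x. U (rad x) * f (rad x))"
    using assms by (intro covers_ball_vertices) simp
  then have "wnorm_sq m (\<lambda>x. W (rad x)) (\<lambda>x. U (rad x) * f (rad x))
      = (\<Sum>r\<le>N. \<Sum>x\<in>S r. W (rad x) * (U (rad x) * f (rad x))\<^sup>2 * m x)"
    by (simp add: wnorm_sq_eq_sum sum_ball_vertices)
  also have "\<dots> = (\<Sum>r\<le>N. \<Sum>x\<in>S r. (f r)\<^sup>2 * ((U r)\<^sup>2 * W r * m x))"
    by (intro sum.cong refl) (auto simp: sph_def power_mult_distrib)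
  finally show ?thesis by (simp add: vol_eq_sum sum_distrib_left)
qed

end

section \<open>Logarithmic cutoffs\<close>

text \<open>Harmonic numbers replace the logarithm: the cutoff starts at 1, drops by
  \<open>1 / ((r + 1) * harm (Suc n))\<close> at each step from \<open>r\<close> to
  \<open>r + 1\<close> with \<open>r \<le> n\<close>, and reaches 0 at \<open>Suc n\<close>. Using
  \<open>Suc n\<close> keeps the denominator positive.\<close>

definition log_cutoff :: "nat \<Rightarrow> nat \<Rightarrow> real" where
  "log_cutoff n r = 1 - harm (min r (Suc n)) / harm (Suc n)"

lemma harm_pos_Suc: "harm (Suc n) > (0::real)"
  by (intro harm_pos) simp

lemma harm_Suc_neq_0: "harm (Suc n) \<noteq> (0::real)"
  using harm_pos_Suc by (rule less_imp_neq[symmetric])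

lemma log_cutoff_eq_0: "Suc n \<le> r \<Longrightarrow> log_cutoff n r = 0"
  by (simp add: log_cutoff_def min_def harm_Suc_neq_0)

lemma log_cutoff_bounds: "0 \<le> log_cutoff n r" "log_cutoff n r \<le> 1"
proof -
  have "harm (min r (Suc n)) \<le> (harm (Suc n) :: real)" by (intro harm_mono) simp
  then show "0 \<le> log_cutoff n r"
    using harm_pos_Suc[of n] by (simp add: log_cutoff_def)
  show "log_cutoff n r \<le> 1"
    unfolding log_cutoff_def by (simp add: divide_nonneg_nonneg harm_nonneg)
qed

lemma harm_Suc_at_top: "filterlim (\<lambda>n. harm (Suc n) :: real) at_top sequentially"
  using harm_at_top by (rule filterlim_compose) (rule filterlim_Suc)

lemma log_cutoff_tendsto: "(\<lambda>n. log_cutoff n r) \<longlonglongrightarrow> 1"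
proof -
  have "(\<lambda>n. 1 - harm r / harm (Suc n)) \<longlonglongrightarrow> 1 - (0::real)"
    by (intro tendsto_diff tendsto_divide_0[OF tendsto_const] tendsto_const filterlim_at_top_imp_at_infinity harm_Suc_at_top)
  moreover have "eventually (\<lambda>n. 1 - harm r / harm (Suc n) = log_cutoff n r) sequentially"
    using eventually_ge_at_top[of r] by eventually_elim (simp add: log_cutoff_def min_def)
  ultimately show ?thesis by (simp add: filterlim_cong)
qed

text \<open>A squared step of order \<open>1 / (r + 1)^2\<close> against conductance at most
  \<open>C * (r + 1)\<close> leaves a harmonic sum, which cancels one of the two factors
  \<open>harm (Suc n)\<close> in the denominator.\<close>

lemma log_cutoff_energy_le:
  assumes c: "\<And>r. 0 \<le> c r" "\<And>r. c r \<le> C * (real r + 1)"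
  shows "(\<Sum>r<N. c r * (log_cutoff n r - log_cutoff n (Suc r))\<^sup>2) \<le> C / harm (Suc n)"
proof -
  let ?t = "\<lambda>r. c r * (log_cutoff n r - log_cutoff n (Suc r))\<^sup>2"
  let ?H = "harm (Suc n) :: real"
  have harm_eq: "harm n = (\<Sum>r<n. inverse (real (Suc r)))" for n
    by (induction n) (simp_all add: harm_Suc, simp add: harm_def)
  have nn: "?t r \<ge> 0" for r using c(1) by simp
  have H: "?H > 0" by (rule harm_pos_Suc)
  have le: "?t r \<le> C / ?H\<^sup>2 * inverse (real (Suc r))" if "r < Suc n" for r
  proof -
    have "log_cutoff n r - log_cutoff n (Suc r) = (harm (Suc r) - harm r) / ?H"
      using that by (simp add: log_cutoff_def min_def diff_divide_distrib)
    also have "\<dots> = inverse (real (Suc r)) / ?H" by (simp add: harm_Suc)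
    finally have "?t r = c r * (inverse (real (Suc r)))\<^sup>2 / ?H\<^sup>2"
      by (simp add: power_divide)
    also have "\<dots> \<le> (C * (real r + 1)) * (inverse (real (Suc r)))\<^sup>2 / ?H\<^sup>2"
      using c(2) by (intro divide_right_mono mult_right_mono) auto
    also have "\<dots> = C / ?H\<^sup>2 * inverse (real (Suc r))"
      by (simp add: power2_eq_square inverse_eq_divide add.commute)
    finally show ?thesis .
  qed
  \<comment> \<open>The range may end before or after the zero of the cutoff; the maximum treats
    both cases.\<close>
  have "(\<Sum>r<N. ?t r) \<le> (\<Sum>r<max N (Suc n). ?t r)"
    using nn by (intro sum_mono2) auto
  also have "\<dots> = (\<Sum>r<Suc n. ?t r)"
    by (rule sum.mono_neutral_right) (auto simp: log_cutoff_eq_0)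
  also have "\<dots> \<le> (\<Sum>r<Suc n. C / ?H\<^sup>2 * inverse (real (Suc r)))"
    using le by (intro sum_mono) simp
  also have "\<dots> = C / ?H\<^sup>2 * ?H"
    unfolding sum_distrib_left[symmetric] harm_eq ..
  also have "\<dots> = C / ?H"
    using H by (simp add: power2_eq_square)
  finally show ?thesis .
qed

lemma log_cutoff_energy_tendsto:
  assumes "\<And>r. 0 \<le> c r" "\<And>r. c r \<le> C * (real r + 1)"
  shows "(\<lambda>n. \<Sum>r<N n. c r * (log_cutoff n r - log_cutoff n (Suc r))\<^sup>2) \<longlonglongrightarrow> 0"
    (is "?D \<longlonglongrightarrow> 0")
proof (rule tendsto_sandwich[OF always_eventually always_eventually tendsto_const])
  show "(\<lambda>n. C / harm (Suc n)) \<longlonglongrightarrow> 0"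
    by (intro tendsto_divide_0[OF tendsto_const] filterlim_at_top_imp_at_infinity harm_Suc_at_top)
  show "\<forall>n. ?D n \<le> C / harm (Suc n)" using assms by (intro allI log_cutoff_energy_le)
  show "\<forall>n. 0 \<le> ?D n" using assms(1) by (intro allI sum_nonneg) simp
qed

section \<open>Elementary estimates for divergence\<close>

lemma partial_sums_unbounded:
  fixes h :: "nat \<Rightarrow> real"
  assumes h: "\<And>r. 0 \<le> h r" and c: "c > 0" and le: "\<And>r. r \<ge> R \<Longrightarrow> c / real r \<le> h r"
  shows "\<exists>N. (\<Sum>r<N. h r) > M"
proof (rule ccontr)
  assume "\<not> ?thesis"
  then have "summable h" by (intro summableI_nonneg_bounded[of h M] h) (simp add: not_less)
  then have "summable (\<lambda>r. c / real r)"
    by (rule summable_comparison_test_ev[rotated])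
       (use le c in \<open>auto intro!: eventually_sequentiallyI[of R]\<close>)
  then have "summable (\<lambda>r. (1 / c) * (c / real r))" by (rule summable_mult)
  then show False using not_summable_harmonic[where 'a = real] c by (simp add: inverse_eq_divide)
qed

text \<open>This is the arithmetic-geometric mean inequality with its exact defect; the defect is
  what later makes the weight large enough.\<close>

lemma sqrt_mult_eq_mean:
  assumes "a \<ge> 0" "b \<ge> 0"
  shows "sqrt (a * b) = (a + b) / 2 - (sqrt a - sqrt b)\<^sup>2 / 2"
  using assms by (simp add: power2_diff real_sqrt_mult field_simps)

text \<open>Factor \<open>a - b\<close> as a difference of squares and bound the squared sum of the
  roots by \<open>2 * (a + b)\<close>.\<close>

lemma power2_sqrt_diff_ge:
  assumes "a > 0" "b > 0" "a + b \<le> D"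
  shows "(sqrt a - sqrt b)\<^sup>2 \<ge> (a - b)\<^sup>2 / (2 * D)"
proof -
  have eq: "(a - b)\<^sup>2 = (sqrt a - sqrt b)\<^sup>2 * (sqrt a + sqrt b)\<^sup>2"
    using assms by (simp flip: power_mult_distrib) (simp add: algebra_simps)
  have "0 \<le> (sqrt a - sqrt b)\<^sup>2" by simp
  then have "(sqrt a + sqrt b)\<^sup>2 \<le> 2 * (a + b)"
    using assms by (simp add: power2_sum power2_diff)
  then have "(sqrt a + sqrt b)\<^sup>2 \<le> 2 * D" using assms by simp
  then have "(a - b)\<^sup>2 \<le> (sqrt a - sqrt b)\<^sup>2 * (2 * D)"
    unfolding eq by (intro mult_left_mono) auto
  then show ?thesis using assms by (simp add: pos_divide_le_eq)
qed

section \<open>The Hardy weight\<close>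

locale convex_curvature_graph = weakly_spherical_graph b m Os
  for b :: "'a \<Rightarrow> 'a \<Rightarrow> real" and m :: "'a \<Rightarrow> real" and Os :: "'a set" +
  fixes \<gamma> :: real
  assumes curvature_bounded: "bounded (curv_ratio b m Os ` {x. radius b Os x \<ge> 1})"
    and curvature_1: "curv_ratio_r b m Os 1 \<ge> 2"
    and curvature_step: "\<forall>r::nat. r \<ge> 2 \<longrightarrow>
           curv_ratio_r b m Os r \<ge> 1 / real r + (1 - 1 / real r) * curv_ratio_r b m Os (r - 1)"
    and gamma_ge: "1 / (k_plus_r b m Os 0 * vol b m Os 0) \<le> \<gamma>"
    and gamma_le: "\<gamma> \<le> (curv_ratio_r b m Os 1 - 1) / (k_plus_r b m Os 0 * vol b m Os 0)"
begin

abbreviation "\<kappa> \<equiv> curv_ratio_r b m Os"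
abbreviation "kp \<equiv> k_plus_r b m Os"
abbreviation "km \<equiv> k_minus_r b m Os"
abbreviation "W \<equiv> w_gamma_r b m Os \<gamma>"

text \<open>In terms of \<open>\<delta> r\<close>, hypothesis (ii) says that \<open>\<delta>\<close> is nondecreasing,
  and \<open>\<delta> = 0\<close> is the case of equality.\<close>

definition \<delta> :: "nat \<Rightarrow> real" where
  "\<delta> r = real r * \<kappa> r - (real r + 1)"

lemma delta_Suc_mono: "r \<ge> 1 \<Longrightarrow> \<delta> r \<le> \<delta> (Suc r)"
proof -
  assume "r \<ge> 1"
  then have "\<kappa> (Suc r) \<ge> 1 / real (Suc r) + (1 - 1 / real (Suc r)) * \<kappa> r"
    using curvature_step[rule_format, of "Suc r"] by simp
  then have step: "real (Suc r) * (1 / real (Suc r) + (1 - 1 / real (Suc r)) * \<kappa> r)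
      \<le> real (Suc r) * \<kappa> (Suc r)"
    by (intro mult_left_mono) auto
  have "real (Suc r) * (1 / real (Suc r) + (1 - 1 / real (Suc r)) * \<kappa> r)
      = 1 + real r * \<kappa> r"
    by (simp add: field_simps)
  with step have "1 + real r * \<kappa> r \<le> real (Suc r) * \<kappa> (Suc r)" by (simp only:)
  then show ?thesis by (simp add: \<delta>_def)
qed

lemma delta_mono:
  assumes "r \<le> s" "1 \<le> r"
  shows "\<delta> r \<le> \<delta> s"
  using assms(1)
proof (induction rule: dec_induct)
  case (step n)
  then show ?case using delta_Suc_mono[of n] assms(2) by simp
qed simp

text \<open>The starting value is \<open>\<delta> 1 = \<kappa> 1 - 2\<close>; this is where
  \<open>\<kappa> 1 \<ge> 2\<close> enters.\<close>

lemma delta_nonneg: "r \<ge> 1 \<Longrightarrow> \<delta> r \<ge> 0"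
  using delta_mono[of 1 r] curvature_1 by (simp add: \<delta>_def)

lemma curvature_pos: "r \<ge> 1 \<Longrightarrow> \<kappa> r > 0"
proof -
  assume r: "r \<ge> 1"
  then have "real r * \<kappa> r > 0" using delta_nonneg[of r] by (simp add: \<delta>_def)
  then show ?thesis using r by (simp add: zero_less_mult_iff)
qed

text \<open>On an empty sphere \<open>radial\<close> returns 0, contradicting the positivity of
  \<open>\<kappa>\<close>. Hence the graph is infinite and all curvature ratios are genuine.\<close>

lemma sphere_Suc_nonempty: "S (Suc r) \<noteq> {}"
  using curvature_pos[of "Suc r"] by (auto simp: radial_def)

lemma flux_positive: "flux r > 0"
  by (intro flux_pos sphere_Suc_nonempty)

lemma vol_Suc_pos: "vol b m Os (Suc r) > 0"
  by (intro vol_pos sphere_Suc_nonempty)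

lemma k_minus_pos: "km (Suc r) > 0"
  using flux_eq_k_minus[of r] flux_positive[of r] vol_Suc_pos[of r]
  by (simp add: zero_less_mult_iff)

lemma curvature_eq: "\<kappa> (Suc r) = kp (Suc r) / km (Suc r)"
proof -
  obtain x where x: "rad x = Suc r" using sphere_Suc_nonempty[of r] by (auto simp: sph_def)
  show ?thesis
    using radial_radius[OF spherical_k(1), of x] radial_radius[OF spherical_k(2), of x]
      radial_radius[OF spherical_k(3), of x] x by (simp add: curv_ratio_def)
qed

lemma k_plus_eq: "kp (Suc r) = \<kappa> (Suc r) * km (Suc r)"
  using curvature_eq[of r] k_minus_pos[of r] by simp

lemma flux_Suc: "flux (Suc r) = \<kappa> (Suc r) * flux r"
  using flux_eq_k_plus[of "Suc r"] flux_eq_k_minus[of r] k_plus_eq[of r] by simp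

lemma curvature_le:
  obtains C where "C > 0" "\<And>r. \<kappa> (Suc r) \<le> C"
proof -
  obtain C where C: "\<And>x. rad x \<ge> 1 \<Longrightarrow> \<bar>curv_ratio b m Os x\<bar> \<le> C"
    using curvature_bounded by (auto simp: bounded_iff)
  have le: "\<kappa> (Suc r) \<le> C" for r
  proof -
    obtain x where x: "rad x = Suc r" using sphere_Suc_nonempty[of r] by (auto simp: sph_def)
    then show ?thesis
      using C[of x] radial_radius[OF spherical_k(3), of x] by simp
  qed
  moreover have "C > 0" using le[of 0] curvature_1 by simp
  ultimately show ?thesis using that by blast
qed

section \<open>The radial ground state\<close>

lemma gamma_bounds: "1 \<le> flux 0 * \<gamma>" "flux 0 * \<gamma> \<le> \<kappa> 1 - 1" "\<gamma> > 0"
proof -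
  have pos: "kp 0 * vol b m Os 0 > 0" using flux_positive[of 0] flux_eq_k_plus[of 0] by simp
  show "1 \<le> flux 0 * \<gamma>" "flux 0 * \<gamma> \<le> \<kappa> 1 - 1"
    using gamma_ge gamma_le pos by (simp_all add: flux_eq_k_plus field_simps)
  then show "\<gamma> > 0" using flux_positive[of 0] by (smt (verit) zero_less_mult_iff)
qed

text \<open>The general formula would give 0 at \<open>r = 0\<close>, where a positive value is
  needed; the parameter \<open>\<gamma>\<close> supplies it.\<close>

definition U :: "nat \<Rightarrow> real" where
  "U r = (if r = 0 then sqrt \<gamma> else sqrt (real r / flux (r - 1)))"

lemma U_pos: "U r > 0"
  using gamma_bounds(3) flux_positive[of "r - 1"] by (simp add: U_def)

lemma U_0: "U 0 = sqrt (flux 0 * \<gamma>) * U 1"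
  using flux_positive[of 0] by (simp add: U_def real_sqrt_mult real_sqrt_divide)

text \<open>Here \<open>U (r + 1) / U r = sqrt ((1 + 1 / r) / \<kappa> r)\<close> for
  \<open>r \<ge> 1\<close>. The factor \<open>\<kappa>\<close> is kept on the left because the
  outward Laplacian term is \<open>km r * \<kappa> r * U (r + 1)\<close>; this yields the first root
  in the weight, and \<open>U_Suc\<close> yields the second.\<close>

lemma U_Suc_Suc:
  "\<kappa> (Suc r) * U (Suc (Suc r)) = sqrt (\<kappa> (Suc r) * (1 + 1 / real (Suc r))) * U (Suc r)"
proof -
  have k: "\<kappa> (Suc r) > 0" and f: "flux r > 0" using curvature_pos flux_positive by simp_all
  have "\<kappa> (Suc r) * U (Suc (Suc r)) = sqrt ((\<kappa> (Suc r))\<^sup>2 * (real (Suc (Suc r)) / flux (Suc r)))"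
    using k unfolding real_sqrt_mult by (simp add: U_def)
  also have "(\<kappa> (Suc r))\<^sup>2 * (real (Suc (Suc r)) / flux (Suc r))
      = (\<kappa> (Suc r) * (1 + 1 / real (Suc r))) * (real (Suc r) / flux r)"
    unfolding flux_Suc using k f by (simp add: power2_eq_square divide_simps)
  finally show ?thesis unfolding real_sqrt_mult by (simp add: U_def)
qed

lemma U_Suc:
  "U (Suc r) = sqrt (\<kappa> (Suc r) * (1 - 1 / real (Suc (Suc r)))) * U (Suc (Suc r))"
proof -
  have k: "\<kappa> (Suc r) > 0" and f: "flux r > 0" using curvature_pos flux_positive by simp_all
  have "real (Suc r) / flux r
      = (\<kappa> (Suc r) * (1 - 1 / real (Suc (Suc r)))) * (real (Suc (Suc r)) / flux (Suc r))"
    unfolding flux_Suc using k f by (simp add: divide_simps)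
  then show ?thesis unfolding U_def by (simp flip: real_sqrt_mult)
qed

text \<open>Both \<open>kp 0 * vol b m Os 0\<close> and \<open>km 1 * vol b m Os 1\<close> equal
  \<open>flux 0\<close>, so the single number \<open>flux 0 * \<gamma>\<close> governs the weight on
  the first two spheres.\<close>

lemma W_0: "W 0 = kp 0 * (1 - 1 / sqrt (flux 0 * \<gamma>))"
  by (simp add: w_gamma_r_def Let_def flux_eq_k_plus)

lemma W_1: "W 1 = km 1 * (1 + \<kappa> 1 - sqrt (2 * \<kappa> 1) - sqrt (flux 0 * \<gamma>))"
  by (simp add: w_gamma_r_def Let_def flux_eq_k_minus)

lemma W_Suc_Suc:
  "W (Suc (Suc r)) = km (Suc (Suc r)) * (1 + \<kappa> (Suc (Suc r))
     - sqrt (\<kappa> (Suc (Suc r)) * (1 + 1 / real (Suc (Suc r))))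
     - sqrt (\<kappa> (Suc r) * (1 - 1 / real (Suc (Suc r)))))"
  by (simp add: w_gamma_r_def Let_def)

text \<open>The weight is exactly \<open>-\<Delta>U / U\<close>. Radius 0 is special because there
  are no inward edges, and radius 1 because the inner value \<open>U 0\<close> involves
  \<open>\<gamma>\<close>.\<close>

lemma neg_laplacian_U:
  "neg_laplacian b m (\<lambda>x. U (rad x)) x = w_gamma b m Os \<gamma> x * U (rad x)"
proof -
  consider "rad x = 0" | "rad x = 1" | r where "rad x = Suc (Suc r)"
    by (cases "rad x" rule: nat.exhaust) (metis One_nat_def nat.exhaust)+
  then show ?thesis
  proof cases
    case 1
    have "sqrt (flux 0 * \<gamma>) \<noteq> 0" using gamma_bounds(1) by auto
    then have "U 1 = 1 / sqrt (flux 0 * \<gamma>) * U 0" unfolding U_0 by (simp only: mult.assoc[symmetric]) simp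
    then have "kp 0 * (U 0 - U 1) = W 0 * U 0" by (simp add: W_0 algebra_simps)
    then show ?thesis using neg_laplacian_radial_0[OF 1, of U] by (simp add: w_gamma_def 1)
  next
    case 2
    have "neg_laplacian b m (\<lambda>x. U (rad x)) x
        = km 1 * (\<kappa> 1 * U 1 - \<kappa> 1 * U (Suc 1)) + km 1 * (U 1 - U 0)"
      using neg_laplacian_radial_Suc[of x 0 U] 2 k_plus_eq[of 0] by (simp add: algebra_simps)
    also have "\<kappa> 1 * U (Suc 1) = sqrt (2 * \<kappa> 1) * U 1"
      using U_Suc_Suc[of 0] by (simp add: mult.commute)
    finally show ?thesis by (simp add: w_gamma_def 2 W_1[simplified] U_0 algebra_simps)
  next
    case (3 r)
    let ?r = "Suc (Suc r)"
    have "neg_laplacian b m (\<lambda>x. U (rad x)) x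
        = km ?r * (\<kappa> ?r * U ?r - \<kappa> ?r * U (Suc ?r)) + km ?r * (U ?r - U (Suc r))"
      unfolding neg_laplacian_radial_Suc[OF 3] k_plus_eq by (simp add: algebra_simps)
    also have "\<dots> = W ?r * U ?r"
      unfolding U_Suc_Suc[of "Suc r"] U_Suc[of r] W_Suc_Suc by (simp only: algebra_simps)
    finally show ?thesis by (simp add: w_gamma_def 3)
  qed
qed

section \<open>Contribution of each sphere to the norm of the ground state\<close>

definition density :: "nat \<Rightarrow> real" where
  "density r = (U r)\<^sup>2 * W r * vol b m Os r"

text \<open>With \<open>s * \<kappa> s = s + 1 + \<delta> s\<close> and
  \<open>(s - 1) * \<kappa> (s - 1) = s + \<delta> (s - 1)\<close> the two roots become geometric
  means. Writing each as the arithmetic mean minus its defect leaves the linear part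
  \<open>(\<delta> s - \<delta> (s - 1)) / 2\<close>, so all three terms are nonnegative.\<close>

lemma density_Suc_Suc:
  fixes r defines "s \<equiv> Suc (Suc r)"
  shows "density s = (\<delta> s - \<delta> (Suc r)) / 2
    + (sqrt (real s + 1 + \<delta> s) - sqrt (real s + 1))\<^sup>2 / 2
    + (sqrt (real s + \<delta> (Suc r)) - sqrt (real s))\<^sup>2 / 2"
proof -
  have d: "\<delta> s \<ge> 0" "\<delta> (Suc r) \<ge> 0" using delta_nonneg by (simp_all add: s_def)
  have s: "real s > 0" by (simp add: s_def)
  have "(U s)\<^sup>2 = real s / flux (Suc r)"
    using flux_positive[of "Suc r"] by (simp add: U_def s_def)
  moreover have "flux (Suc r) = km s * vol b m Os s" unfolding s_def by (rule flux_eq_k_minus)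
  ultimately have "density s = real s * (1 + \<kappa> s
      - sqrt (\<kappa> s * (1 + 1 / real s)) - sqrt (\<kappa> (Suc r) * (1 - 1 / real s)))"
    using k_minus_pos[of "Suc r"] vol_Suc_pos[of "Suc r"]
    unfolding density_def s_def W_Suc_Suc by simp
  also have "\<dots> = real s + real s * \<kappa> s
      - sqrt ((real s)\<^sup>2 * (\<kappa> s * (1 + 1 / real s)))
      - sqrt ((real s)\<^sup>2 * (\<kappa> (Suc r) * (1 - 1 / real s)))"
    unfolding real_sqrt_mult by (simp add: algebra_simps)
  also have "(real s)\<^sup>2 * (\<kappa> s * (1 + 1 / real s)) = (real s + 1 + \<delta> s) * (real s + 1)"
    using s by (simp add: \<delta>_def power2_eq_square field_simps)
  also have "(real s)\<^sup>2 * (\<kappa> (Suc r) * (1 - 1 / real s)) = (real s + \<delta> (Suc r)) * real s"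
  proof -
    have "(real s)\<^sup>2 * (k * (1 - 1 / real s)) = (real s - 1) * k * real s" for k
      using s by (simp add: power2_eq_square field_simps)
    moreover have "real s + \<delta> (Suc r) = (real s - 1) * \<kappa> (Suc r)"
      by (simp add: \<delta>_def s_def)
    ultimately show ?thesis by (simp only:)
  qed
  also have "real s * \<kappa> s = real s + 1 + \<delta> s" by (simp add: \<delta>_def)
  finally show ?thesis
    using d s by (subst (asm) (1 2) sqrt_mult_eq_mean) (auto simp: field_simps)
qed

text \<open>The lower bound on \<open>\<gamma>\<close> handles radius 0, the upper bound radius 1;
  from radius 2 on the sign is that of the density.\<close>

lemma W_nonneg: "W r \<ge> 0"
proof -
  consider "r = 0" | "r = 1" | s where "r = Suc (Suc s)"
    by (cases r rule: nat.exhaust) (metis One_nat_def nat.exhaust)+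
  then show ?thesis
  proof cases
    case 1
    have "kp 0 * vol b m Os 0 > 0" using flux_positive[of 0] flux_eq_k_plus[of 0] by simp
    moreover have "vol b m Os 0 \<ge> 0"
      unfolding vol_eq_sum using measure_pos by (intro sum_nonneg) (simp add: less_imp_le)
    ultimately have "kp 0 > 0" by (auto simp: zero_less_mult_iff)
    moreover have "sqrt (flux 0 * \<gamma>) \<ge> 1" using gamma_bounds(1) by simp
    ultimately show ?thesis unfolding 1 W_0 by simp
  next
    case 2
    have k: "\<kappa> 1 \<ge> 2" by (rule curvature_1)
    \<comment> \<open>The two mean bounds \<open>(2 + \<kappa> 1) / 2\<close> and
      \<open>\<kappa> 1 / 2\<close> add up to exactly \<open>1 + \<kappa> 1\<close>.\<close>
    have "sqrt (2 * \<kappa> 1) \<le> (2 + \<kappa> 1) / 2"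
      using arith_geo_mean_sqrt[of 2 "\<kappa> 1"] k by simp
    moreover have "sqrt (flux 0 * \<gamma>) \<le> sqrt (\<kappa> 1 - 1)" using gamma_bounds by simp
    moreover have "sqrt (\<kappa> 1 - 1) \<le> \<kappa> 1 / 2"
      using arith_geo_mean_sqrt[of 1 "\<kappa> 1 - 1"] k by simp
    moreover have "0 \<le> 1 + k - p - q" if "p \<le> (2 + k) / 2" "q \<le> q'" "q' \<le> k / 2" for k p q q' :: real
      using that by simp
    ultimately have "1 + \<kappa> 1 - sqrt (2 * \<kappa> 1) - sqrt (flux 0 * \<gamma>) \<ge> 0" by blast
    then show ?thesis unfolding 2 W_1 using k_minus_pos[of 0] by simp
  next
    case (3 s)
    have "density r \<ge> 0"
      unfolding 3 density_Suc_Suc using delta_Suc_mono[of "Suc s"] by simp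
    moreover have "(U r)\<^sup>2 * vol b m Os r > 0"
      unfolding 3 using U_pos[of r] vol_Suc_pos[of "Suc s"] U_pos[of "Suc (Suc s)"] by simp
    moreover have "density r = W r * ((U r)\<^sup>2 * vol b m Os r)"
      by (simp add: density_def)
    ultimately show ?thesis by (simp add: zero_le_mult_iff)
  qed
qed

lemma density_nonneg: "density r \<ge> 0"
proof -
  have "vol b m Os r \<ge> 0"
    unfolding vol_eq_sum using measure_pos by (intro sum_nonneg) (simp add: less_imp_le)
  then show ?thesis using W_nonneg by (simp add: density_def)
qed

text \<open>In the case of equality \<open>\<kappa> 1 = 2\<close>, so the admissible interval for
  \<open>\<gamma>\<close> shrinks to \<open>flux 0 * \<gamma> = 1\<close>.\<close>

lemma W_eq_0:
  assumes "\<And>r. r \<ge> 1 \<Longrightarrow> \<delta> r = 0"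
  shows "W r = 0"
proof -
  have k1: "\<kappa> 1 = 2" using assms[of 1] by (simp add: \<delta>_def)
  then have g: "flux 0 * \<gamma> = 1" using gamma_bounds by simp
  consider "r = 0" | "r = 1" | s where "r = Suc (Suc s)"
    by (cases r rule: nat.exhaust) (metis One_nat_def nat.exhaust)+
  then show ?thesis
  proof cases
    case (3 s)
    have "density r = 0" unfolding 3 density_Suc_Suc using assms by simp
    then show ?thesis
      using U_pos[of r] vol_Suc_pos[of "Suc s"] by (simp add: density_def 3)
  qed (simp_all add: W_0 W_1[simplified] g k1[simplified])
qed

text \<open>A nonzero weight forces \<open>\<delta> R > 0\<close> for some \<open>R\<close>, and
  monotonicity keeps \<open>\<delta>\<close> above this value. Since \<open>\<kappa>\<close> is
  bounded, the first defect term is then at least a constant over \<open>r\<close>.\<close>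

lemma density_partial_sums_unbounded:
  assumes "w_gamma b m Os \<gamma> x \<noteq> 0"
  shows "\<exists>N. (\<Sum>r<N. density r) > M"
proof -
  have "\<exists>r\<ge>1. \<delta> r \<noteq> 0" using assms W_eq_0 by (auto simp: w_gamma_def)
  then obtain R where R: "R \<ge> 1" "\<delta> R > 0" using delta_nonneg by force
  obtain C where C: "C > 0" "\<And>r. \<kappa> (Suc r) \<le> C" by (rule curvature_le) blast
  show ?thesis
  proof (rule partial_sums_unbounded[OF density_nonneg])
    \<comment> \<open>One factor 2 comes from the estimate of the root difference with
      \<open>D = r * (C + 2)\<close>, the other from the half in the density.\<close>
    show "(\<delta> R)\<^sup>2 / (4 * (C + 2)) > 0" using R C by simp
    fix r assume "r \<ge> Suc R"
    \<comment> \<open>Starting at \<open>Suc R\<close> ensures \<open>r \<ge> 2\<close>, where the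
      density formula holds.\<close>
    then obtain s where r: "r = Suc (Suc s)" using R by (metis Suc_le_D Suc_le_mono One_nat_def)
    have d: "\<delta> r \<ge> \<delta> R" using delta_mono R \<open>r \<ge> Suc R\<close> by simp
    have "real r * \<kappa> r \<le> real r * C" using C(2)[of "Suc s"] by (intro mult_left_mono) (auto simp: r)
    then have le: "(real r + 1 + \<delta> r) + (real r + 1) \<le> real r * (C + 2)"
      using r by (simp add: \<delta>_def algebra_simps)
    have "(\<delta> R)\<^sup>2 / (4 * (C + 2)) / real r \<le> (\<delta> r)\<^sup>2 / (4 * (C + 2)) / real r"
      using d R(2) C(1) by (intro divide_right_mono power_mono) auto
    also have "\<dots> = (\<delta> r)\<^sup>2 / (2 * (real r * (C + 2))) / 2" by (simp add: mult_ac)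
    also have "\<dots> \<le> (sqrt (real r + 1 + \<delta> r) - sqrt (real r + 1))\<^sup>2 / 2"
      using power2_sqrt_diff_ge[OF _ _ le] d R(2) by simp
    also have "\<dots> \<le> density r"
      unfolding r density_Suc_Suc using delta_Suc_mono[of "Suc s"] by simp
    finally show "(\<delta> R)\<^sup>2 / (4 * (C + 2)) / real r \<le> density r" .
  qed
qed

section \<open>Cutoffs of the ground state and criticality\<close>

definition conductance :: "nat \<Rightarrow> real" where
  "conductance r = flux r * U r * U (Suc r)"

lemma conductance_nonneg: "conductance r \<ge> 0"
  unfolding conductance_def
  using flux_positive[of r] U_pos[of r] U_pos[of "Suc r"] by simp

text \<open>For \<open>r \<ge> 1\<close> the square of \<open>conductance r\<close> is
  \<open>\<kappa> r * r * (r + 1)\<close>, so boundedness of \<open>\<kappa>\<close> gives linear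
  growth. The value at 0 depends on \<open>\<gamma>\<close> and is absorbed into the
  constant.\<close>

lemma conductance_le:
  obtains C where "\<And>r. conductance r \<le> C * (real r + 1)"
proof -
  obtain C where C: "C > 0" "\<And>r. \<kappa> (Suc r) \<le> C" by (rule curvature_le) blast
  have "conductance r \<le> (conductance 0 + sqrt C) * (real r + 1)" for r
  proof (cases r)
    case 0
    then show ?thesis using C(1) by simp
  next
    case (Suc s)
    have f: "flux (Suc s) > 0" "flux s > 0" by (rule flux_positive)+
    have "conductance (Suc s) = sqrt ((flux (Suc s))\<^sup>2 *
        (real (Suc s) / flux s) * (real (Suc (Suc s)) / flux (Suc s)))"
      unfolding real_sqrt_mult using f by (simp add: conductance_def U_def)
    also have "(flux (Suc s))\<^sup>2 * (real (Suc s) / flux s) * (real (Suc (Suc s)) / flux (Suc s))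
        = \<kappa> (Suc s) * (real (Suc s) * real (Suc (Suc s)))"
      using f curvature_pos[of "Suc s"] unfolding flux_Suc by (simp add: power2_eq_square)
    also have "sqrt \<dots> \<le> sqrt (C * (real (Suc (Suc s)))\<^sup>2)"
      using C by (intro real_sqrt_le_mono mult_mono) (auto simp: power2_eq_square)
    also have "\<dots> = sqrt C * (real r + 1)"
      by (simp add: real_sqrt_mult Suc)
    also have "\<dots> \<le> (conductance 0 + sqrt C) * (real r + 1)"
      using conductance_nonneg[of 0] by (intro mult_right_mono) auto
    finally show ?thesis by (simp add: Suc)
  qed
  then show ?thesis using that by blast
qed

lemma wnorm_sq_U:
  assumes "\<And>r. N \<le> r \<Longrightarrow> f r = 0"
  shows "wnorm_sq m (w_gamma b m Os \<gamma>) (\<lambda>x. U (rad x) * f (rad x))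
    = (\<Sum>r\<le>N. (f r)\<^sup>2 * density r)"
  using wnorm_sq_radial[of N f W U] assms
  by (simp add: density_def w_gamma_def[abs_def])

text \<open>Since \<open>U\<close> solves the equation exactly, the ground state representation has
  no remainder beyond the path energy of \<open>f\<close>.\<close>

lemma energy_U:
  assumes "\<And>r. N \<le> r \<Longrightarrow> f r = 0"
  shows "energy b (\<lambda>x. U (rad x) * f (rad x)) =
    (\<Sum>r<N. conductance r * (f r - f (Suc r))\<^sup>2)
    + wnorm_sq m (w_gamma b m Os \<gamma>) (\<lambda>x. U (rad x) * f (rad x))"
proof -
  let ?u = "\<lambda>x. U (rad x)"
  have w: "(\<lambda>x. neg_laplacian b m ?u x / ?u x) = w_gamma b m Os \<gamma>"
  proof
    fix x
    show "neg_laplacian b m ?u x / ?u x = w_gamma b m Os \<gamma> x"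
      unfolding neg_laplacian_U using U_pos[of "rad x"] by simp
  qed
  have "covers (ball_vertices N) (\<lambda>x. ?u x * f (rad x))"
    using assms by (intro covers_ball_vertices) simp
  from ground_state_representation[OF this, of ?u] show ?thesis
    unfolding w conductance_def by (simp add: U_pos ground_state_form_radial)
qed

lemma finite_support_U:
  assumes "\<And>r. N \<le> r \<Longrightarrow> f r = 0"
  shows "finite {x. U (rad x) * f (rad x) \<noteq> 0}"
proof (rule finite_subset[OF _ finite_ball_vertices])
  show "{x. U (rad x) * f (rad x) \<noteq> 0} \<subseteq> ball_vertices N"
    using assms by (auto simp: not_le) (meson not_le less_imp_le)
qed

lemma positive_supersolution_U:
  "positive_supersolution b m (w_gamma b m Os \<gamma>) (\<lambda>x. U (rad x))"
  unfolding positive_supersolution_def neg_laplacian_U by (simp add: U_pos)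

text \<open>The functions \<open>U\<close> times \<open>log_cutoff n\<close> converge pointwise to
  \<open>U\<close>, and their form values are path energies of the cutoffs, which tend to 0.\<close>

lemma agmon_ground_state_U:
  "agmon_ground_state b m (w_gamma b m Os \<gamma>) (\<lambda>x. U (rad x))"
proof (rule agmon_ground_stateI[where \<phi> = "\<lambda>n x. U (rad x) * log_cutoff n (rad x)"])
  fix n show "finite {x. U (rad x) * log_cutoff n (rad x) \<noteq> 0}"
    by (rule finite_support_U[of "Suc n"]) (rule log_cutoff_eq_0)
next
  fix x
  have "(\<lambda>n. U (rad x) * log_cutoff n (rad x)) \<longlonglongrightarrow> U (rad x) * 1"
    by (intro tendsto_intros log_cutoff_tendsto)
  then show "(\<lambda>n. U (rad x) * log_cutoff n (rad x)) \<longlonglongrightarrow> U (rad x)" by simp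
next
  obtain C where C: "\<And>r. conductance r \<le> C * (real r + 1)" by (rule conductance_le) blast
  have "energy b (\<lambda>x. U (rad x) * log_cutoff n (rad x)) -
      wnorm_sq m (w_gamma b m Os \<gamma>) (\<lambda>x. U (rad x) * log_cutoff n (rad x)) =
      (\<Sum>r<Suc n. conductance r * (log_cutoff n r - log_cutoff n (Suc r))\<^sup>2)" for n
    using energy_U[of "Suc n" "log_cutoff n", OF log_cutoff_eq_0] by linarith
  then show "(\<lambda>n. energy b (\<lambda>x. U (rad x) * log_cutoff n (rad x)) -
      wnorm_sq m (w_gamma b m Os \<gamma>) (\<lambda>x. U (rad x) * log_cutoff n (rad x))) \<longlonglongrightarrow> 0"
    using log_cutoff_energy_tendsto[OF conductance_nonneg C, of Suc]
    by (simp only:)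
qed (rule connected positive_supersolution_U)+

section \<open>Null-criticality and optimality near infinity\<close>

lemma null_critical_w_gamma:
  assumes "w_gamma b m Os \<gamma> x \<noteq> 0"
  shows "null_critical b m (w_gamma b m Os \<gamma>)"
proof (rule null_criticalI[OF agmon_ground_state_U])
  show "0 \<le> w_gamma b m Os \<gamma> x" for x by (simp add: w_gamma_def W_nonneg)
  fix M
  obtain N where N: "(\<Sum>r<N. density r) > M"
    using density_partial_sums_unbounded[OF assms] by blast
  have "(\<Sum>x\<in>ball_vertices N. (U (rad x))\<^sup>2 * w_gamma b m Os \<gamma> x * m x) = (\<Sum>r\<le>N. density r)"
    unfolding sum_ball_vertices density_def vol_eq_sum sum_distrib_left
    by (intro sum.cong refl) (auto simp: sph_def w_gamma_def)
  also have "\<dots> \<ge> (\<Sum>r<N. density r)"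
    using density_nonneg by (intro sum_mono2) auto
  finally show "\<exists>F. finite F \<and> M \<le> (\<Sum>x\<in>F. (U (rad x))\<^sup>2 * w_gamma b m Os \<gamma> x * m x)"
    using N finite_ball_vertices[of N] by (intro exI[of _ "ball_vertices N"]) simp
qed

text \<open>Removing a ball from the null sequence costs a bounded amount of energy, while the
  weighted norm still diverges by null-criticality.\<close>

lemma optimal_near_infinity_w_gamma:
  assumes "w_gamma b m Os \<gamma> x \<noteq> 0"
  shows "optimal_near_infinity b m (w_gamma b m Os \<gamma>)"
  unfolding optimal_near_infinity_def
proof (intro allI impI)
  fix l :: real and K :: "'a set" assume l: "l > 0" and K: "finite K"
  obtain R where R: "\<And>x. x \<in> K \<Longrightarrow> rad x < R"
    using finite_imageI[OF K, of rad] by (auto simp: finite_nat_set_iff_bounded)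
  define f where "f n r = (if r < R then 0 else log_cutoff n r)" for n r
  define c0 where "c0 = (\<Sum>r<R. conductance r)"
  have f0: "f n r = 0" if "Suc n \<le> r" for n r
    using that by (simp add: f_def log_cutoff_eq_0)
  obtain C where C: "\<And>r. conductance r \<le> C * (real r + 1)" by (rule conductance_le) blast
  let ?E = "\<lambda>n. \<Sum>r<Suc n. conductance r * (log_cutoff n r - log_cutoff n (Suc r))\<^sup>2"
  let ?D = "\<lambda>n. \<Sum>r<Suc n. conductance r * (f n r - f n (Suc r))\<^sup>2"
  have D: "?D n \<le> ?E n + c0" for n
  proof -
    have "conductance r * (f n r - f n (Suc r))\<^sup>2
        \<le> conductance r * (log_cutoff n r - log_cutoff n (Suc r))\<^sup>2
          + (if r < R then conductance r else 0)" for r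
    \<comment> \<open>Below \<open>R\<close> the function \<open>f n\<close> changes by at most 1
      per step, and only in the step onto radius \<open>R\<close>; from \<open>R\<close> on it
      agrees with the logarithmic cutoff.\<close>
    proof (cases "r < R")
      case True
      have "(f n r - f n (Suc r))\<^sup>2 \<le> 1"
        using True log_cutoff_bounds[of n "Suc r"] by (simp add: f_def power_le_one)
      then have "conductance r * (f n r - f n (Suc r))\<^sup>2 \<le> conductance r"
        using conductance_nonneg by (intro mult_left_le) auto
      then show ?thesis using True conductance_nonneg by (simp add: add_increasing)
    qed (simp add: f_def)
    then have "?D n \<le> (\<Sum>r<Suc n. conductance r * (log_cutoff n r - log_cutoff n (Suc r))\<^sup>2
          + (if r < R then conductance r else 0))"
      by (intro sum_mono)
    also have "\<dots> = ?E n + (\<Sum>r<Suc n. if r < R then conductance r else 0)"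
      by (rule sum.distrib)
    also have "(\<Sum>r<Suc n. if r < R then conductance r else 0)
        = (\<Sum>r\<in>{..<Suc n} \<inter> {r. r < R}. conductance r)"
      by (simp add: sum.inter_restrict)
    also have "\<dots> \<le> c0"
      unfolding c0_def using conductance_nonneg by (intro sum_mono2) auto
    finally show ?thesis by simp
  qed
  have "?E \<longlonglongrightarrow> 0" by (rule log_cutoff_energy_tendsto[OF conductance_nonneg C])
  then have E: "eventually (\<lambda>n. ?E n < 1) sequentially"
    by (rule order_tendstoD) simp
  \<comment> \<open>Even without the radii below \<open>R\<close>, the sum exceeds
    \<open>(1 + c0) / l\<close>, so that \<open>l\<close> times the norm will beat the energy bound
    \<open>1 + c0\<close>.\<close>
  obtain N where N: "(\<Sum>r<N. density r) > (1 + c0) / l + (\<Sum>r<R. density r)"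
    using density_partial_sums_unbounded[OF assms] by blast
  let ?g = "\<lambda>r. if r < R then 0 else density r"
  have "(\<Sum>r<N. density r) = (\<Sum>r<N. ?g r) + (\<Sum>r<N. if r < R then density r else 0)"
    unfolding sum.distrib[symmetric] by (intro sum.cong) auto
  also have "(\<Sum>r<N. if r < R then density r else 0)
      = (\<Sum>r\<in>{..<N} \<inter> {r. r < R}. density r)"
    by (simp add: sum.inter_restrict)
  also have "\<dots> \<le> (\<Sum>r<R. density r)"
    using density_nonneg by (intro sum_mono2) auto
  finally have "(1 + c0) / l < (\<Sum>r<N. ?g r)" using N by simp
  \<comment> \<open>The range \<open>N\<close> is fixed while \<open>n\<close> grows, so the cutoff
    tends to 1 on each of its finitely many radii.\<close>
  moreover have "(\<lambda>n. \<Sum>r<N. (f n r)\<^sup>2 * density r) \<longlonglongrightarrow> (\<Sum>r<N. ?g r)"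
  proof (rule tendsto_sum)
    fix r
    have "(\<lambda>n. (log_cutoff n r)\<^sup>2 * density r) \<longlonglongrightarrow> 1\<^sup>2 * density r"
      by (intro tendsto_intros log_cutoff_tendsto)
    then show "(\<lambda>n. (f n r)\<^sup>2 * density r) \<longlonglongrightarrow> ?g r"
      by (cases "r < R") (simp_all add: f_def)
  qed
  ultimately have "eventually (\<lambda>n. (1 + c0) / l < (\<Sum>r<N. (f n r)\<^sup>2 * density r)) sequentially"
    by (rule order_tendstoD(1)[rotated])
  with E have "eventually (\<lambda>n. ?E n < 1 \<and> (1 + c0) / l < (\<Sum>r<N. (f n r)\<^sup>2 * density r) \<and> N \<le> n)
      sequentially"
    using eventually_ge_at_top[of N] by eventually_elim simp
  from eventually_happens'[OF sequentially_bot this]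
  obtain n where n: "?E n < 1" "(1 + c0) / l < (\<Sum>r<N. (f n r)\<^sup>2 * density r)" "N \<le> n"
    by (elim exE conjE)
  let ?\<phi> = "\<lambda>x. U (rad x) * f n (rad x)"
  let ?w = "wnorm_sq m (w_gamma b m Os \<gamma>) ?\<phi>"
  have "(\<Sum>r<N. (f n r)\<^sup>2 * density r) \<le> (\<Sum>r\<le>Suc n. (f n r)\<^sup>2 * density r)"
    using n(3) density_nonneg by (intro sum_mono2) auto
  also have "\<dots> = ?w" by (rule wnorm_sq_U[symmetric]) (rule f0)
  finally have "(1 + c0) / l < ?w" using n(2) by simp
  then have "1 + c0 < l * ?w" using l by (simp add: pos_divide_less_eq mult.commute)
  moreover have "energy b ?\<phi> = ?D n + ?w" by (rule energy_U) (rule f0)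
  ultimately have "energy b ?\<phi> < (1 + l) * ?w"
    using D[of n] n(1) by (simp only: distrib_right)
  moreover have "?\<phi> \<in> Cc (UNIV - K)"
    using finite_support_U[of "Suc n" "f n", OF f0] R by (auto simp: Cc_def f_def)
  ultimately show "\<exists>\<phi>\<in>Cc (UNIV - K).
      energy b \<phi> < (1 + l) * wnorm_sq m (w_gamma b m Os \<gamma>) \<phi>" by blast
qed

lemma hardy_inequality_w_gamma:
  "\<phi> \<in> Cc UNIV \<Longrightarrow> energy b \<phi> \<ge> wnorm_sq m (w_gamma b m Os \<gamma>) \<phi>"
  using hardy_inequality[OF _ positive_supersolution_U] by (simp add: Cc_def)

text \<open>Nonvanishing is part of being a Hardy weight, and it also yields the
  \<open>\<delta> R > 0\<close> behind both null-criticality and optimality near infinity.\<close>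

lemma optimal_hardy_weight_w_gamma:
  assumes "w_gamma b m Os \<gamma> x \<noteq> 0"
  shows "optimal_hardy_weight b m (w_gamma b m Os \<gamma>)"
  unfolding optimal_hardy_weight_def
proof (intro conjI)
  show "hardy_weight b m (w_gamma b m Os \<gamma>)"
    unfolding hardy_weight_def
    using hardy_inequality_w_gamma assms by (auto simp: w_gamma_def[abs_def] W_nonneg)
  show "critical b m (w_gamma b m Os \<gamma>)"
    using agmon_ground_state_U unfolding critical_def by blast
qed (rule null_critical_w_gamma optimal_near_infinity_w_gamma, rule assms)+

end

theorem theorem3p9:
  fixes b :: "'a \<Rightarrow> 'a \<Rightarrow> real" and m :: "'a \<Rightarrow> real" and Os :: "'a set" and \<gamma> :: real
  assumes "weighted_graph b m"
    and "connected_graph b"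
    and "locally_finite_graph b"
    and "finite Os" and "Os \<noteq> {}"
    and "weakly_spherically_symmetric b m Os"
    and "bounded (curv_ratio b m Os ` {x. radius b Os x \<ge> 1})"
    and "curv_ratio_r b m Os 1 \<ge> 2"
    and "\<forall>r::nat. r \<ge> 2 \<longrightarrow>
           curv_ratio_r b m Os r \<ge> 1 / real r + (1 - 1 / real r) * curv_ratio_r b m Os (r - 1)"
    and "1 / (k_plus_r b m Os 0 * vol b m Os 0) \<le> \<gamma>"
    and "\<gamma> \<le> (curv_ratio_r b m Os 1 - 1) / (k_plus_r b m Os 0 * vol b m Os 0)"
  shows "(\<forall>\<phi>\<in>Cc UNIV. energy b \<phi> \<ge> wnorm_sq m (w_gamma b m Os \<gamma>) \<phi>) \<and>
         ((\<exists>x. w_gamma b m Os \<gamma> x \<noteq> 0) \<longrightarrow> optimal_hardy_weight b m (w_gamma b m Os \<gamma>))"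
proof -
  interpret convex_curvature_graph b m Os \<gamma>
    using assms
    by (intro convex_curvature_graph.intro weakly_spherical_graph.intro
        locally_finite_weighted_graph.intro locally_finite_weighted_graph_axioms.intro
        weakly_spherical_graph_axioms.intro convex_curvature_graph_axioms.intro)
  show ?thesis
    using hardy_inequality_w_gamma optimal_hardy_weight_w_gamma by blast
qed

end
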